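(* Let $H=H_0+K$ be the Hamiltonian constructed in the context, with parameters $\alpha>1$, $\beta>0$. The property "for every $z_0\in\mathbb{R}^2$ such that the solution of $\dot z=J\nabla_zH(t,z)$, $z(0)=z_0$ blows up at a finite time $\bar t\in(0,T]$, one has $\lim_{t\to\bar t^-}\mathrm{rot}_t(z_0)=+\infty$" holds if and only if $\beta(\alpha-1)\ge1$.
   Context: $|\cdot|$ and $\langle\cdot,\cdot\rangle$ are the Euclidean norm and scalar product on $\mathbb{R}^2$; $J=\begin{pmatrix}0&1\\-1&0\end{pmatrix}$. Clockwise canonical polar coordinates: $z=(x,y)=(\sqrt{2\rho}\cos\theta,-\sqrt{2\rho}\sin\theta)$, so $|z|=\sqrt{2\rho}$; in these coordinates the system $\dot z=J\nabla_zH(t,z)$ reads $\dot\theta=\partial H/\partial\rho$, $\dot\rho=-\partial H/\partial\theta$. Construction. Fix $T>0$, $T_{\mathrm F}\in(0,T]$, $\alpha>1$, $\beta>0$, $\sigma_0\ge T_{\mathrm F}^{\beta-1}$, and set for $t\in[0,T_{\mathrm F})$ $$\theta^*(t)=\alpha(\sigma_0T_{\mathrm F})^{\alpha-1}\int_0^t(T_{\mathrm F}-s)^{-\beta(\alpha-1)}\,ds,\qquad \rho^*(t)=\frac{\sigma_0T_{\mathrm F}}{(T_{\mathrm F}-t)^\beta}$$ (so $\rho^*(0)\ge1$). Fix a small $\epsilon>0$ and let: - $f\colon[0,T_{\mathrm F})\times\mathbb{R}\to(-\epsilon,\epsilon)$, $f=f(t,u)$, be $C^\infty$, $2\pi$-periodic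 in $u$, with $\|f\|_\infty<\epsilon$ and, for every $t\in[0,T_{\mathrm F})$: $\frac{\partial f}{\partial u}(t,0)=-\dot\rho^*(t)=-\frac{\sigma_0T_{\mathrm F}\beta}{(T_{\mathrm F}-t)^{\beta+1}}$, $-\dot\rho^*(t)\le\frac{\partial f}{\partial u}(t,\cdot)<\frac{\beta}{T_{\mathrm F}}$, and $\mathrm{supp}\,f(t,\cdot)=[-1/2,1/2]+2\pi\mathbb{Z}$; - $g\colon\mathbb{R}\to[0,1]$ be $C^\infty$ with $\mathrm{supp}\,g=[-1/2,1/2]$, $g(0)=1$, $g'(0)=0$ and $\|g'\|_\infty\le L_g$ for some constant $L_g$. Define $H(t,\theta,\rho)=H_0(\rho)+K(t,\theta,\rho)$ with $H_0(\rho)=\rho^\alpha$ and $$K(t,\theta,\rho)=\begin{cases}f(t,\theta-\theta^*(t))\,g(\rho-\rho^*(t))&t\in[0,T_{\mathrm F}),\\0&t\in[T_{\mathrm F},T),\end{cases}$$ extended $T$-periodically to $t\in\mathbb{R}$; since $K=0$ for $\rho<\frac12$, $H$ extends to the origin with value $0$, and is regarded as a function $H(t,z)$ on $\mathbb{R}\times\mathbb{R}^2$. The solution $z(\cdot)$ with $z(0)=z_0$ blows up at a finite time $\bar t$ if its maximal interval of existence to the right of $0$ is $[0,\bar t)$. Clockwise rotation: if $z(\cdot)$ exists on $[0,t]$ and does not vanish there, $\mathrm{rot}_t(z_0)=\frac1{2\pi}\int_0^t\frac{\langle J\nabla_zH(s,z(s)),Jz(s)\rangle}{|z(s)|^2}\,ds$.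 (Here $z\equiv0$ is a solution, so solutions with $z_0\ne0$ never vanish.) *)

theory Defs
  imports "HOL-Analysis.Analysis" "HOL-Library.Real_Mod"
begin

text \<open>
  \<open>C\<^sup>k\<close> and \<open>C\<^sup>\<infinity>\<close> functions on a subset of a Euclidean space. Derivatives are taken within \<open>S\<close>
  (hence one-sided at boundary points); on a convex set with nonempty interior, such as
  \<open>{0..<c} \<times> UNIV\<close>, they are unique.
\<close>

primrec Ck_on :: "nat \<Rightarrow> 'a::euclidean_space set \<Rightarrow> ('a \<Rightarrow> 'b::real_normed_vector) \<Rightarrow> bool" where
  "Ck_on 0 S f \<longleftrightarrow> continuous_on S f"
| "Ck_on (Suc k) S f \<longleftrightarrow>
     (\<exists>D. (\<forall>x\<in>S. (f has_derivative D x) (at x within S)) \<and> (\<forall>v. Ck_on k S (\<lambda>x. D x v)))"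

definition smooth_on :: "'a::euclidean_space set \<Rightarrow> ('a \<Rightarrow> 'b::real_normed_vector) \<Rightarrow> bool" where
  "smooth_on S f \<longleftrightarrow> (\<forall>k. Ck_on k S f)"

definition supp :: "(real \<Rightarrow> real) \<Rightarrow> real set" where
  "supp h = closure {x. h x \<noteq> 0}"

definition gradient :: "('a::real_inner \<Rightarrow> real) \<Rightarrow> 'a \<Rightarrow> 'a" where
  "gradient F z = (THE D. GDERIV F z :> D)"

definition J :: "real^2^2" where
  "J = vector [vector [0, 1], vector [-1, 0]]"

text \<open>
  Clockwise canonical polar coordinates. The angle of a point is only determined modulo \<open>2\<pi>\<close>;
  \<open>angle\<close> picks the representative in \<open>[-\<pi>, \<pi>)\<close>, which is immaterial for functions that are
  \<open>2\<pi>\<close>-periodic in the angle (see \<open>hamiltonian_polar\<close> below).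
\<close>

definition polar :: "real \<Rightarrow> real \<Rightarrow> real^2" where
  "polar \<theta> \<rho> = vector [sqrt (2 * \<rho>) * cos \<theta>, - (sqrt (2 * \<rho>) * sin \<theta>)]"

definition angle :: "real^2 \<Rightarrow> real" where
  "angle z = - Arg (Complex (z $ 1) (z $ 2))"

definition action :: "real^2 \<Rightarrow> real" where
  "action z = (norm z)\<^sup>2 / 2"

definition theta_star :: "real \<Rightarrow> real \<Rightarrow> real \<Rightarrow> real \<Rightarrow> real \<Rightarrow> real" where
  "theta_star T\<^sub>F \<alpha> \<beta> \<sigma>\<^sub>0 t =
     \<alpha> * (\<sigma>\<^sub>0 * T\<^sub>F) powr (\<alpha> - 1) * integral {0..t} (\<lambda>s. (T\<^sub>F - s) powr (- \<beta> * (\<alpha> - 1)))"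

definition rho_star :: "real \<Rightarrow> real \<Rightarrow> real \<Rightarrow> real \<Rightarrow> real" where
  "rho_star T\<^sub>F \<beta> \<sigma>\<^sub>0 t = \<sigma>\<^sub>0 * T\<^sub>F / (T\<^sub>F - t) powr \<beta>"

definition K :: "real \<Rightarrow> real \<Rightarrow> real \<Rightarrow> real \<Rightarrow> real \<Rightarrow> (real \<Rightarrow> real \<Rightarrow> real) \<Rightarrow> (real \<Rightarrow> real)
    \<Rightarrow> real \<Rightarrow> real \<Rightarrow> real \<Rightarrow> real" where
  "K T T\<^sub>F \<alpha> \<beta> \<sigma>\<^sub>0 f g t \<theta> \<rho> =
     (let s = t rmod T in
      if s < T\<^sub>F then f s (\<theta> - theta_star T\<^sub>F \<alpha> \<beta> \<sigma>\<^sub>0 s) * g (\<rho> - rho_star T\<^sub>F \<beta> \<sigma>\<^sub>0 s) else 0)"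

definition hamiltonian :: "real \<Rightarrow> real \<Rightarrow> real \<Rightarrow> real \<Rightarrow> real \<Rightarrow> (real \<Rightarrow> real \<Rightarrow> real) \<Rightarrow> (real \<Rightarrow> real)
    \<Rightarrow> real \<Rightarrow> real^2 \<Rightarrow> real" where
  "hamiltonian T T\<^sub>F \<alpha> \<beta> \<sigma>\<^sub>0 f g t z =
     (if z = 0 then 0 else action z powr \<alpha> + K T T\<^sub>F \<alpha> \<beta> \<sigma>\<^sub>0 f g t (angle z) (action z))"

text \<open>
  Solutions of \<open>z' = J \<nabla>H(t, z)\<close>, \<open>z(0) = z\<^sub>0\<close> on an interval \<open>I\<close> with left endpoint \<open>0 \<in> I\<close>, in the
  sense of Caratheodory: a \<open>T\<close>-periodic \<open>H\<close> may jump at multiples of \<open>T\<close>, where a classical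
  solution would stop without blowing up.
\<close>

definition ham_solution :: "(real \<Rightarrow> real^2 \<Rightarrow> real) \<Rightarrow> real^2 \<Rightarrow> real set \<Rightarrow> (real \<Rightarrow> real^2) \<Rightarrow> bool"
  where
  "ham_solution H z0 I z \<longleftrightarrow>
     (\<forall>t\<in>I. (\<lambda>r. J *v gradient (H r) (z r)) absolutely_integrable_on {0..t} \<and>
            z t = z0 + integral {0..t} (\<lambda>r. J *v gradient (H r) (z r)))"

text \<open>
  \<open>z\<close> is the solution starting at \<open>z\<^sub>0\<close>, and its maximal interval of existence to the right of \<open>0\<close>
  is \<open>[0, b)\<close>.
\<close>

definition blows_up_at :: "(real \<Rightarrow> real^2 \<Rightarrow> real) \<Rightarrow> real^2 \<Rightarrow> (real \<Rightarrow> real^2) \<Rightarrow> real \<Rightarrow> bool" where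
  "blows_up_at H z0 z b \<longleftrightarrow>
     0 < b \<and> ham_solution H z0 {0..<b} z \<and>
     (\<nexists>I w. is_interval I \<and> I \<subseteq> {0..} \<and> {0..<b} \<subset> I \<and> ham_solution H z0 I w \<and>
            (\<forall>t\<in>{0..<b}. w t = z t))"

definition rot :: "(real \<Rightarrow> real^2 \<Rightarrow> real) \<Rightarrow> (real \<Rightarrow> real^2) \<Rightarrow> real \<Rightarrow> real" where
  "rot H z t = 1 / (2 * pi) *
     integral {0..t} (\<lambda>r. ((J *v gradient (H r) (z r)) \<bullet> (J *v z r)) / (norm (z r))\<^sup>2)"

lemma gradient_eq:
  assumes "GDERIV F z :> D"
  shows "gradient F z = D"
proof -
  have "D' = D" if "GDERIV F z :> D'" for D'
  proof -
    have "(\<lambda>h. inner h D') = (\<lambda>h. inner h D)"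
      using assms that has_derivative_unique unfolding gderiv_def by blast
    then show ?thesis
      by (metis vector_eq_ldot)
  qed
  with assms show ?thesis
    unfolding gradient_def by blast
qed

lemma action_polar: "\<rho> \<ge> 0 \<Longrightarrow> action (polar \<theta> \<rho>) = \<rho>"
  by (simp add: action_def polar_def norm_vec_def L2_set_def UNIV_2 power_mult_distrib
      flip: distrib_left)

lemma angle_polar:
  assumes "\<rho> > 0"
  shows "\<exists>n::int. angle (polar \<theta> \<rho>) = \<theta> + 2 * pi * of_int n"
proof -
  have *: "Complex (polar \<theta> \<rho> $ 1) (polar \<theta> \<rho> $ 2) = of_real (sqrt (2 * \<rho>)) * cis (- \<theta>)"
    by (simp add: polar_def complex_eq_iff)
  let ?a = "Arg (of_real (sqrt (2 * \<rho>)) * cis (- \<theta>))"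
  have "cis ?a = cis (- \<theta>)"
    using assms by (subst cis_Arg) (auto simp: sgn_mult sgn_of_real sgn_eq norm_mult)
  then obtain n :: int where "?a = - \<theta> + 2 * pi * of_int n"
    using sin_cos_eq_iff[of ?a "- \<theta>"] by (auto simp: cis.ctr complex_eq_iff mult_ac simp del: cos_minus sin_minus)
  then show ?thesis
    unfolding angle_def * by (intro exI[of _ "-n"]) simp
qed

lemma periodic_int_shift:
  fixes h :: "real \<Rightarrow> real"
  assumes "\<And>u. h (u + p) = h u"
  shows "h (u + p * of_int n) = h u"
proof -
  have nat: "h (u + p * of_nat m) = h u" for u m
  proof (induction m)
    case (Suc m)
    then show ?case
      using assms[of "u + p * of_nat m"] by (simp add: algebra_simps)
  qed simp
  show ?thesis
  proof (cases "n \<ge> 0")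
    case True
    then show ?thesis using nat[of u "nat n"] by simp
  next
    case False
    then show ?thesis using nat[of "u + p * of_int n" "nat (- n)"] by (simp add: algebra_simps)
  qed
qed

lemma hamiltonian_polar:
  assumes "T > 0" and "\<rho> > 0"
    and "\<And>t u. t \<in> {0..<T\<^sub>F} \<Longrightarrow> f t (u + 2 * pi) = f t u"
  shows "hamiltonian T T\<^sub>F \<alpha> \<beta> \<sigma>\<^sub>0 f g t (polar \<theta> \<rho>) = \<rho> powr \<alpha> + K T T\<^sub>F \<alpha> \<beta> \<sigma>\<^sub>0 f g t \<theta> \<rho>"
proof -
  have a: "action (polar \<theta> \<rho>) = \<rho>"
    using assms(2) by (simp add: action_polar)
  then have nz: "polar \<theta> \<rho> \<noteq> 0"
    using assms(2) by (auto simp: action_def)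
  obtain n :: int where n: "angle (polar \<theta> \<rho>) = \<theta> + 2 * pi * of_int n"
    using angle_polar[OF assms(2)] by blast
  have "f s (\<theta> + 2 * pi * of_int n - c) = f s (\<theta> - c)" if "s \<in> {0..<T\<^sub>F}" for s c
    using periodic_int_shift[of "f s" "2 * pi" "\<theta> - c" n] assms(3)[OF that]
    by (simp add: algebra_simps)
  moreover have "t rmod T \<ge> 0"
    using assms(1) by (intro rmod_nonneg) simp
  ultimately show ?thesis
    using nz by (simp add: hamiltonian_def K_def Let_def a n)
qed

lemma deriv_rho_star:
  assumes "t < T\<^sub>F"
  shows "deriv (rho_star T\<^sub>F \<beta> \<sigma>\<^sub>0) t = \<sigma>\<^sub>0 * T\<^sub>F * \<beta> / (T\<^sub>F - t) powr (\<beta> + 1)"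
proof (rule DERIV_imp_deriv)
  have "((\<lambda>t. \<sigma>\<^sub>0 * T\<^sub>F * (T\<^sub>F - t) powr (- \<beta>)) has_real_derivative
      \<sigma>\<^sub>0 * T\<^sub>F * \<beta> / (T\<^sub>F - t) powr (\<beta> + 1)) (at t)"
    using assms by (auto intro!: derivative_eq_intros simp: powr_minus_divide powr_add powr_diff field_simps)
  then show "(rho_star T\<^sub>F \<beta> \<sigma>\<^sub>0 has_real_derivative
      \<sigma>\<^sub>0 * T\<^sub>F * \<beta> / (T\<^sub>F - t) powr (\<beta> + 1)) (at t)"
    by (simp add: rho_star_def[abs_def] powr_minus_divide)
qed

end

theory Submission
  imports Defs
begin

text \<open>
  Along a solution the action \<open>\<rho>\<close> and the speed of rotation are \<open>\<rho>' = - \<partial>H/\<partial>\<theta>\<close> and \<open>\<partial>H/\<partial>\<rho>\<close>, and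
  \<open>\<rho> - \<rho>\<^sup>*\<close> never increases before \<open>T\<^sub>F\<close> because \<open>f\<^sub>u \<ge> - d\<rho>\<^sup>*/dt\<close> and \<open>0 \<le> g \<le> 1\<close>. Hence \<open>\<rho>\<close>
  is bounded on \<open>[0, b)\<close> for every \<open>b < T\<^sub>F\<close>, it is constant after \<open>T\<^sub>F\<close>, and a solution can only blow up at \<open>T\<^sub>F\<close>. If \<open>\<rho>\<close>
  ever drops below \<open>\<rho>\<^sup>* - 1/2\<close>, it leaves the support of \<open>K\<close> for good and does not blow up; so
  \<open>\<rho> \<ge> \<rho>\<^sup>* - 1/2 \<ge> \<rho>\<^sup>*/2\<close> for a solution that does. Up to a bounded error its rotation is then
  at least a multiple of \<open>\<theta>\<^sup>*\<close>, which diverges if \<open>\<beta> (\<alpha> - 1) \<ge> 1\<close>. If \<open>\<beta> (\<alpha> - 1) < 1\<close>, the spiral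
  \<open>(\<theta>\<^sup>*, \<rho>\<^sup>*)\<close> itself is a solution that blows up with bounded rotation.
\<close>

section \<open>Local branches of the polar angle\<close>

lemma J_nth [simp]: "(J *v z) $ 1 = z $ 2" "(J *v z) $ 2 = - z $ 1"
  by (simp_all add: J_def matrix_vector_mult_def sum_2)

lemma inner_vec_2: "x \<bullet> y = x $ 1 * y $ 1 + x $ 2 * y $ 2" for x y :: "real^2"
  by (simp add: inner_vec_def sum_2)

lemma inner_J_J [simp]: "(J *v x) \<bullet> (J *v y) = x \<bullet> y"
  by (simp add: inner_vec_2)

lemma inner_J_self [simp]: "z \<bullet> (J *v z) = 0" "(J *v z) \<bullet> z = 0"
  by (simp_all add: inner_vec_2)

lemma norm_J [simp]: "norm (J *v z) = norm z"
  by (simp add: norm_eq_sqrt_inner)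

text \<open>
  The branch of the angle that is smooth around the ray of angle \<open>\<theta>\<close>; \<^const>\<open>angle\<close> itself jumps along
  a ray.
\<close>

definition angle_near :: "real \<Rightarrow> real^2 \<Rightarrow> real" where
  "angle_near \<theta> z = \<theta> - Arg (Complex (z $ 1) (z $ 2) * cis \<theta>)"

text \<open>Multiplication by \<open>cis \<theta>\<close> rotates the point, and \<open>Arg\<close>
  is additive modulo \<open>2 * pi\<close>.\<close>

lemma angle_near_eq_angle:
  assumes "z \<noteq> 0"
  obtains n :: int where "angle z = angle_near \<theta> z + 2 * pi * of_int n"
proof -
  let ?c = "Complex (z $ 1) (z $ 2)"
  have "?c \<noteq> 0"
    using assms by (auto simp: vec_eq_iff forall_2 complex_eq_iff)
  then have "cis (Arg (?c * cis \<theta>)) = cis (Arg ?c + \<theta>)"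
    by (simp add: cis_Arg sgn_mult flip: cis_mult)
  then have "[Arg (?c * cis \<theta>) = Arg ?c + \<theta>] (rmod (2 * pi))"
    by (simp add: cis_eq_iff)
  then obtain n :: int where "Arg ?c + \<theta> = Arg (?c * cis \<theta>) + of_int n * (2 * pi)"
    by (auto simp: rcong_altdef)
  then show thesis
    by (intro that[of "-n"]) (simp add: angle_def angle_near_def algebra_simps)
qed

text \<open>Rotated by its own \<open>angle\<close>, a nonzero point lands on the positive real
  axis, away from the cut of \<open>Ln\<close>. There \<open>Arg\<close> is the imaginary part of
  \<open>Ln\<close>, whose derivative in direction \<open>h\<close> is the complex quotient of
  \<open>h\<close> by \<open>z\<close>; minus its imaginary part is the inner product of
  \<open>h\<close> with \<open>J *v z\<close>, divided by \<open>(norm z)\<^sup>2\<close>.\<close>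

lemma angle_near_angle [simp]: "angle_near (angle z) z = angle z"
  and GDERIV_angle_near:
    "z \<noteq> 0 \<Longrightarrow> GDERIV (angle_near (angle z)) z :> (1 / (norm z)\<^sup>2) *\<^sub>R (J *v z)"
proof -
  define c :: "real^2 \<Rightarrow> complex" where "c w = Complex (w $ 1) (w $ 2)" for w
  have "c z * cis (angle z) = cis (Arg (c z)) * cis (- Arg (c z)) * of_real (cmod (c z))"
    using rcis_cmod_Arg[of "c z"] by (simp add: angle_def c_def rcis_def mult_ac)
  then have real: "c z * cis (angle z) = of_real (cmod (c z))"
    by (simp add: cis_mult)
  then show "angle_near (angle z) z = angle z"
    by (simp add: angle_near_def c_def)
  assume nz: "z \<noteq> 0"
  then have cz: "c z \<noteq> 0"
    by (auto simp: c_def vec_eq_iff forall_2 complex_eq_iff)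
  \<comment> \<open>The identification with the complex plane is real linear, hence its own
    derivative.\<close>
  have c_eq: "c = (\<lambda>w. of_real (w $ 1) + \<i> * of_real (w $ 2))"
    by (auto simp: c_def complex_eq_iff)
  have dc: "(c has_derivative c) (at z)"
    unfolding c_eq
    by (auto intro!: derivative_eq_intros bounded_linear.has_derivative[OF bounded_linear_vec_nth])
  have nonpos: "c z * cis (angle z) \<notin> \<real>\<^sub>\<le>\<^sub>0"
    using cz by (simp add: real)
  have "((\<lambda>w. Ln (c w * cis (angle z))) has_derivative
          (\<lambda>h. inverse (c z * cis (angle z)) * (c h * cis (angle z)))) (at z)"
    by (rule has_derivative_compose[OF has_derivative_mult_left[OF dc]
        has_field_derivative_Ln[OF nonpos, unfolded has_field_derivative_def]])
  then have "((\<lambda>w. angle z - Im (Ln (c w * cis (angle z)))) has_derivative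
          (\<lambda>h. - Im (inverse (c z * cis (angle z)) * (c h * cis (angle z))))) (at z)"
    by (auto intro!: derivative_eq_intros)
  also have "(\<lambda>h. - Im (inverse (c z * cis (angle z)) * (c h * cis (angle z)))) =
      (\<lambda>h. h \<bullet> ((1 / (norm z)\<^sup>2) *\<^sub>R (J *v z)))"
  proof
    fix h
    have "inverse (c z * cis (angle z)) * (c h * cis (angle z)) = c h / c z"
      by (simp add: field_simps)
    moreover have "(norm z)\<^sup>2 = (z $ 1)\<^sup>2 + (z $ 2)\<^sup>2"
      by (simp only: power2_norm_eq_inner inner_vec_2) (simp add: power2_eq_square)
    ultimately show "- Im (inverse (c z * cis (angle z)) * (c h * cis (angle z))) = h \<bullet> ((1 / (norm z)\<^sup>2) *\<^sub>R (J *v z))"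
      by (simp add: Im_divide c_def inner_vec_2 diff_divide_distrib)
  qed
  finally have D: "((\<lambda>w. angle z - Im (Ln (c w * cis (angle z)))) has_derivative
      (\<lambda>h. h \<bullet> ((1 / (norm z)\<^sup>2) *\<^sub>R (J *v z)))) (at z)" .
  have "(angle_near (angle z) has_derivative (\<lambda>h. h \<bullet> ((1 / (norm z)\<^sup>2) *\<^sub>R (J *v z)))) (at z)"
  proof (rule has_derivative_transform_within_open[OF D])
    show "open (- {0 :: real^2})"
      by (intro open_Compl closed_singleton)
    show "z \<in> - {0}" using nz by simp
    fix w :: "real^2" assume "w \<in> - {0}"
    then have "c w \<noteq> 0"
      by (auto simp: c_def vec_eq_iff forall_2 complex_eq_iff)
    then show "angle z - Im (Ln (c w * cis (angle z))) = angle_near (angle z) w"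
      by (simp add: angle_near_def c_def Arg_def)
  qed
  then show "GDERIV (angle_near (angle z)) z :> (1 / (norm z)\<^sup>2) *\<^sub>R (J *v z)"
    by (simp add: gderiv_def)
qed

lemma periodic_angle_near:
  fixes h :: "real \<Rightarrow> real"
  assumes "\<And>u. h (u + 2 * pi) = h u" and "z \<noteq> 0"
  shows "h (angle_near \<theta> z - c) = h (angle z - c)"
proof -
  obtain n :: int where "angle z = angle_near \<theta> z + 2 * pi * of_int n"
    using angle_near_eq_angle[OF assms(2)] .
  then show ?thesis
    using periodic_int_shift[of h "2 * pi" "angle_near \<theta> z - c" n] assms(1)
    by (simp add: algebra_simps)
qed

text \<open>Where \<open>angle\<close> jumps it does so by multiples of the period, which
  \<open>h\<close> does not see. Near each time it is replaced by the branch
  \<open>angle_near\<close> taken at the current point, which is continuous there.\<close>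

lemma continuous_on_periodic_angle:
  fixes h :: "real \<Rightarrow> real \<Rightarrow> real"
  assumes h: "continuous_on (S \<times> UNIV) (\<lambda>(t, u). h t u)"
    and per: "\<And>t u. t \<in> S \<Longrightarrow> h t (u + 2 * pi) = h t u"
    and z: "continuous_on S z" and nz: "\<And>t. t \<in> S \<Longrightarrow> z t \<noteq> 0"
    and c: "continuous_on S c"
  shows "continuous_on S (\<lambda>t. h t (angle (z t) - c t))"
  unfolding continuous_on_eq_continuous_within
proof
  fix t assume t: "t \<in> S"
  let ?\<phi> = "\<lambda>r. angle_near (angle (z t)) (z r)"
  have "isCont (angle_near (angle (z t))) (z t)"
    using GDERIV_angle_near[OF nz[OF t]] unfolding gderiv_def
    by (rule has_derivative_continuous)
  then have "continuous (at t within S) ?\<phi>"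
    using z t unfolding continuous_on_eq_continuous_within
    by (metis continuous_within_compose3)
  then have "continuous (at t within S) (\<lambda>r. ?\<phi> r - c r)"
    using c t by (intro continuous_diff) (auto simp: continuous_on_eq_continuous_within)
  then have "((\<lambda>r. (r, ?\<phi> r - c r)) \<longlongrightarrow> (t, ?\<phi> t - c t)) (at t within S)"
    unfolding continuous_within by (intro tendsto_Pair tendsto_ident_at)
  moreover have "\<forall>\<^sub>F r in at t within S. (r, ?\<phi> r - c r) \<in> S \<times> UNIV"
    by (auto simp: eventually_at_filter)
  ultimately have "((\<lambda>r. h r (?\<phi> r - c r)) \<longlongrightarrow> h t (?\<phi> t - c t)) (at t within S)"
    using continuous_on_tendsto_compose[OF h, of "\<lambda>r. (r, ?\<phi> r - c r)" "(t, ?\<phi> t - c t)"] t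
    by simp
  then have "((\<lambda>r. h r (angle (z r) - c r)) \<longlongrightarrow> h t (?\<phi> t - c t)) (at t within S)"
    by (rule Lim_transform_eventually)
      (use periodic_angle_near per nz in \<open>auto simp: eventually_at_filter\<close>)
  then show "continuous (at t within S) (\<lambda>r. h r (angle (z r) - c r))"
    by (simp add: continuous_within)
qed

lemma GDERIV_action: "GDERIV action z :> z"
  unfolding gderiv_def action_def power2_norm_eq_inner
  by (auto intro!: derivative_eq_intros simp: inner_commute)

lemma action_0 [simp]: "action 0 = 0"
  by (simp add: action_def)

lemma action_pos: "z \<noteq> 0 \<Longrightarrow> action z > 0"
  by (simp add: action_def)

lemma action_nonneg [simp]: "action z \<ge> 0"
  by (simp add: action_def)

lemma continuous_on_action: "continuous_on S z \<Longrightarrow> continuous_on S (\<lambda>t. action (z t))"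
  unfolding action_def by (intro continuous_intros) auto

lemma linear_J: "bounded_linear ((*v) J)"
  by (rule matrix_vector_mul_bounded_linear)

text \<open>Scalar functions times fixed vectors: in this form the curve can be differentiated
  coordinatewise.\<close>

lemma polar_eq: "polar \<theta> \<rho> = (sqrt (2 * \<rho>) * cos \<theta>) *\<^sub>R axis 1 1 - (sqrt (2 * \<rho>) * sin \<theta>) *\<^sub>R axis 2 1"
  by (simp add: polar_def vec_eq_iff forall_2 axis_def)

section \<open>Smoothness and one-sided calculus\<close>

text \<open>The partial derivative in \<open>u\<close> is the total derivative applied to
  \<open>(0, 1)\<close>, whose continuity is the case \<open>v = (0, 1)\<close> of
  \<open>Ck_on\<close>. The whole line over \<open>t\<close> lies in the domain, so this derivative
  is two-sided even when \<open>t\<close> is an endpoint of \<open>S\<close>.\<close>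

lemma smooth_on_section:
  fixes f :: "real \<Rightarrow> real \<Rightarrow> real"
  assumes "smooth_on (S \<times> UNIV) (\<lambda>(t, u). f t u)"
  shows continuous_on_section: "continuous_on (S \<times> UNIV) (\<lambda>(t, u). f t u)"
    and has_real_derivative_section:
      "t \<in> S \<Longrightarrow> (f t has_real_derivative deriv (f t) u) (at u)"
    and continuous_on_deriv_section: "continuous_on (S \<times> UNIV) (\<lambda>(t, u). deriv (f t) u)"
proof -
  show "continuous_on (S \<times> UNIV) (\<lambda>(t, u). f t u)"
    using assms unfolding smooth_on_def by (metis Ck_on.simps(1))
  have "Ck_on (Suc 0) (S \<times> UNIV) (\<lambda>(t, u). f t u)"
    using assms unfolding smooth_on_def by blast
  then obtain D where D: "\<And>x. x \<in> S \<times> UNIV \<Longrightarrow>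
        ((\<lambda>(t, u). f t u) has_derivative D x) (at x within S \<times> UNIV)"
    and cont: "continuous_on (S \<times> UNIV) (\<lambda>x. D x (0, 1))"
    unfolding Ck_on.simps by blast
  have der: "(f t has_real_derivative D (t, u) (0, 1)) (at u)" if t: "t \<in> S" for t u
  proof -
    have "((\<lambda>u. (t, u)) has_derivative (\<lambda>h. (0, h))) (at u)"
      by (auto intro!: derivative_eq_intros)
    moreover have "((\<lambda>(t, u). f t u) has_derivative D (t, u)) (at (t, u) within range (\<lambda>u. (t, u)))"
      using t by (intro has_derivative_subset[OF D]) auto
    ultimately have "(f t has_derivative (\<lambda>h. D (t, u) (0, h))) (at u)"
      using has_derivative_in_compose[of "\<lambda>u. (t, u)" "\<lambda>h. (0, h)" u UNIV "\<lambda>(t, u). f t u" "D (t, u)"]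
      by simp
    then show ?thesis
      by (rule has_derivative_imp_has_field_derivative)
        (rule linear_scale[OF has_derivative_linear[OF D[of "(t, u)"]], of _ "(0, 1)", symmetric,
          unfolded scaleR_Pair real_scaleR_def mult_1_right mult_zero_right], use t in simp)
  qed
  then show "t \<in> S \<Longrightarrow> (f t has_real_derivative deriv (f t) u) (at u)"
    using DERIV_imp_deriv by metis
  have "continuous_on (S \<times> UNIV) (\<lambda>x. D x (0, 1)) \<longleftrightarrow>
      continuous_on (S \<times> UNIV) (\<lambda>(t, u). deriv (f t) u)"
    by (intro continuous_on_cong refl) (auto simp: DERIV_imp_deriv[OF der])
  then show "continuous_on (S \<times> UNIV) (\<lambda>(t, u). deriv (f t) u)"
    using cont by blast
qed

lemma smooth_on_UNIV_real:
  fixes g :: "real \<Rightarrow> real"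
  assumes "smooth_on UNIV g"
  shows "(g has_real_derivative deriv g x) (at x)"
    and "continuous_on UNIV (deriv g)"
proof -
  have "Ck_on (Suc 0) UNIV g"
    using assms unfolding smooth_on_def by blast
  then obtain D where D: "\<And>x. (g has_derivative D x) (at x)"
    and cont: "continuous_on UNIV (\<lambda>x. D x 1)"
    unfolding Ck_on.simps by blast
  have der: "(g has_real_derivative D x 1) (at x)" for x
    using D[of x] by (rule has_derivative_imp_has_field_derivative)
      (rule linear_scale[OF has_derivative_linear[OF D[of x]], of _ 1, symmetric,
        unfolded real_scaleR_def mult_1_right])
  then have "deriv g = (\<lambda>x. D x 1)"
    using DERIV_imp_deriv by blast
  with der cont show "(g has_real_derivative deriv g x) (at x)" "continuous_on UNIV (deriv g)"
    by simp_all
qed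

text \<open>The complement of the support is open, so \<open>h\<close> vanishes in a neighbourhood
  of \<open>x\<close> and not only at \<open>x\<close>.\<close>

lemma not_in_supp:
  assumes "x \<notin> supp h"
  shows "h x = 0" "deriv h x = 0"
proof -
  have zero: "h y = 0" if "y \<in> - supp h" for y
    using that closure_subset[of "{x. h x \<noteq> 0}"] by (auto simp: supp_def)
  with assms show "h x = 0"
    by simp
  have "open (- supp h)"
    unfolding supp_def by (intro open_Compl closed_closure)
  then have "(h has_real_derivative 0) (at x)"
    using has_field_derivative_transform_within_open[of "\<lambda>_. 0" 0 x "- supp h" h] assms zero
    by simp
  then show "deriv h x = 0"
    by (rule DERIV_imp_deriv)
qed

text \<open>Differentiation and continuity are local, so facts about compact intervals carry over to
  half-open ones.\<close>

lemma at_within_atLeastLessThan: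
  fixes a b c t :: real
  assumes "t < c" "c < b"
  shows "at t within {a..<b} = at t within {a..c}"
  by (rule at_within_nhd[of t "{..<c}"]) (use assms in auto)

lemma continuous_on_atLeastLessThan:
  fixes a b :: real
  assumes "\<And>c. c \<in> {a<..<b} \<Longrightarrow> continuous_on {a..c} f"
  shows "continuous_on {a..<b} f"
  unfolding continuous_on_eq_continuous_within
proof
  fix t assume t: "t \<in> {a..<b}"
  then obtain c where c: "t < c" "c < b"
    using dense by auto
  then show "continuous (at t within {a..<b}) f"
    using assms[of c] t unfolding at_within_atLeastLessThan[OF c] continuous_on_eq_continuous_within
    by auto
qed

lemma integral_has_vector_derivative_atLeastLessThan:
  fixes F :: "real \<Rightarrow> 'a::banach"
  assumes "continuous_on {a..<b} F" and t: "t \<in> {a..<b}"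
  shows "((\<lambda>t. integral {a..t} F) has_vector_derivative F t) (at t within {a..<b})"
proof -
  obtain c where c: "t < c" "c < b"
    using t dense by auto
  have "continuous_on {a..c} F"
    using assms(1) by (rule continuous_on_subset) (use c in auto)
  then show ?thesis
    unfolding at_within_atLeastLessThan[OF c]
    by (rule integral_has_vector_derivative) (use c t in auto)
qed

text \<open>All comparisons below use this form: the difference of the two quantities has a
  nonpositive derivative. The derivative at \<open>a\<close> may be one-sided, because the mean
  value argument uses inner points only.\<close>

lemma nonincreasing_of_derivative:
  fixes F F' :: "real \<Rightarrow> real"
  assumes der: "\<And>t. t \<in> {a..<b} \<Longrightarrow> (F has_real_derivative F' t) (at t within {a..<b})"
    and nonpos: "\<And>t. t \<in> {a..<b} \<Longrightarrow> F' t \<le> 0"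
    and st: "a \<le> s" "s \<le> t" "t < b"
  shows "F t \<le> F s"
proof (rule DERIV_nonpos_imp_decreasing_open[OF st(2)])
  have "continuous_on {a..<b} F"
    using der by (rule DERIV_continuous_on)
  then show "continuous_on {s..t} F"
    by (rule continuous_on_subset) (use st in auto)
  fix x assume x: "s < x" "x < t"
  then have "at x within {a..<b} = at x"
    by (intro at_within_interior) (use st in auto)
  then show "\<exists>y. (F has_real_derivative y) (at x) \<and> y \<le> 0"
    using der[of x] nonpos[of x] x st by auto
qed

section \<open>Solutions and their blow-up\<close>

text \<open>
  The maximal interval being half-open, it suffices to extend the solution to \<open>[0, b]\<close> by its limit,
  so that no local existence theorem is needed.
\<close>

lemma not_blows_up_at_if_bounded:
  assumes sol: "ham_solution H z0 {0..<b} z" and c: "0 \<le> c" "c < b"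
    and cont: "continuous_on {c..<b} (\<lambda>r. J *v gradient (H r) (z r))"
    and bound: "\<And>r. r \<in> {c..<b} \<Longrightarrow> norm (J *v gradient (H r) (z r)) \<le> M"
  shows "\<not> blows_up_at H z0 z b"
proof -
  define v where "v = (\<lambda>r. J *v gradient (H r) (z r))"
  have "v absolutely_integrable_on {0..c}"
    using sol c by (auto simp: ham_solution_def v_def)
  moreover have "v absolutely_integrable_on {c..<b}"
  proof (rule measurable_bounded_by_integrable_imp_absolutely_integrable)
    show "v \<in> borel_measurable (lebesgue_on {c..<b})"
      using cont by (intro continuous_imp_measurable_on_sets_lebesgue) (auto simp: v_def)
    show "(\<lambda>_. M) integrable_on {c..<b}"
      by (rule integrable_on_const) (simp add: bounded_set_imp_lmeasurable)
  qed (use bound in \<open>auto simp: v_def\<close>)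
  ultimately have "v absolutely_integrable_on ({0..c} \<union> {c..<b})"
    by (rule absolutely_integrable_Un)
  also have "{0..c} \<union> {c..<b} = {0..<b}"
    using c by auto
  finally have "v absolutely_integrable_on {0..<b}" .
  then have v: "v absolutely_integrable_on {0..b}"
    by (rule absolutely_integrable_spike_set) (rule negligible_subset[of "{b}"]; auto)+
  \<comment> \<open>The new value at \<open>b\<close> is the limit of the solution. It changes the
    integrand at one point only, which no integral notices.\<close>
  define w where "w = z(b := z0 + integral {0..b} v)"
  have "w t = z0 + integral {0..t} (\<lambda>r. J *v gradient (H r) (w r)) \<and>
        (\<lambda>r. J *v gradient (H r) (w r)) absolutely_integrable_on {0..t}" if t: "t \<in> {0..b}" for t
  proof
    have eq: "J *v gradient (H r) (w r) = v r" if "r \<in> {0..t} - {b}" for r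
      using that by (simp add: w_def v_def)
    have int: "v absolutely_integrable_on {0..t}"
      using absolutely_integrable_on_subinterval[OF v, of 0 t] t by auto
    then show "(\<lambda>r. J *v gradient (H r) (w r)) absolutely_integrable_on {0..t}"
      by (rule absolutely_integrable_spike[of _ _ "{b}"]) (use eq in auto)
    have "integral {0..t} (\<lambda>r. J *v gradient (H r) (w r)) = integral {0..t} v"
      by (rule integral_spike[of "{b}"]) (use eq in auto)
    then show "w t = z0 + integral {0..t} (\<lambda>r. J *v gradient (H r) (w r))"
      using sol t by (cases "t = b") (auto simp: w_def v_def ham_solution_def)
  qed
  then have "ham_solution H z0 {0..b} w"
    by (auto simp: ham_solution_def)
  moreover have "is_interval {0..b}" "{0..b} \<subseteq> {0..}" "{0..<b} \<subset> {0..b}"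
    using c by (auto simp: is_interval_cc)
  moreover have "\<forall>t\<in>{0..<b}. w t = z t"
    by (simp add: w_def)
  ultimately have "\<exists>I w. is_interval I \<and> I \<subseteq> {0..} \<and> {0..<b} \<subset> I \<and> ham_solution H z0 I w \<and>
      (\<forall>t\<in>{0..<b}. w t = z t)"
    by blast
  then show ?thesis
    unfolding blows_up_at_def by blast
qed

lemma ham_solution_continuous_on:
  assumes "ham_solution H z0 I z" and "{0..c} \<subseteq> I"
  shows "continuous_on {0..c} z"
proof (cases "c < 0")
  case False
  let ?v = "\<lambda>r. J *v gradient (H r) (z r)"
  have "?v absolutely_integrable_on {0..c}"
    using assms False unfolding ham_solution_def 
    by (meson atLeastAtMost_iff linorder_not_less order_refl subsetD)
  then have "continuous_on {0..c} (\<lambda>t. z0 + integral {0..t} ?v)"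
    by (intro continuous_intros indefinite_integral_continuous_1 set_lebesgue_integral_eq_integral)
  moreover have "z0 + integral {0..t} ?v = z t" if "t \<in> {0..c}" for t
    using assms that unfolding ham_solution_def by auto
  ultimately show ?thesis
    by (rule continuous_on_eq)
qed simp

lemma ham_solution_continuous_on_half_open:
  assumes "ham_solution H z0 {0..<b} z"
  shows "continuous_on {0..<b} z"
  by (rule continuous_on_atLeastLessThan) (rule ham_solution_continuous_on[OF assms], auto)

text \<open>A Caratheodory solution is a classical one wherever the right-hand side is continuous
  along it. The free left endpoint \<open>a\<close> allows the times before and after a jump of the
  Hamiltonian to be treated separately.\<close>

lemma ham_solution_has_vector_derivative:
  assumes sol: "ham_solution H z0 {0..<b} z" and a: "0 \<le> a" "c \<le> b"
    and cont: "continuous_on {a..<c} (\<lambda>r. J *v gradient (H r) (z r))" and t: "t \<in> {a..<c}"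
  shows "(z has_vector_derivative J *v gradient (H t) (z t)) (at t within {a..<c})"
proof -
  let ?v = "\<lambda>r. J *v gradient (H r) (z r)"
  have "z r = z a + integral {a..r} ?v" if r: "r \<in> {a..<c}" for r
  proof -
    have int: "?v absolutely_integrable_on {0..r}"
      and "z a = z0 + integral {0..a} ?v" "z r = z0 + integral {0..r} ?v"
      using sol a r by (auto simp: ham_solution_def)
    moreover have "integral {0..a} ?v + integral {a..r} ?v = integral {0..r} ?v"
      using a r set_lebesgue_integral_eq_integral(1)[OF int]
      by (intro Henstock_Kurzweil_Integration.integral_combine) auto
    ultimately show ?thesis
      by (simp add: add.assoc)
  qed
  moreover have "((\<lambda>r. z a + integral {a..r} ?v) has_vector_derivative ?v t) (at t within {a..<c})"
    using integral_has_vector_derivative_atLeastLessThan[OF cont t]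
    by (auto intro!: derivative_eq_intros)
  ultimately show ?thesis
    by (rule has_vector_derivative_transform[OF t])
qed

text \<open>A continuation would be continuous, hence bounded, on the compact interval
  \<open>{0..b}\<close>.\<close>

lemma blows_up_at_if_norm_at_top:
  assumes sol: "ham_solution H (z 0) {0..<b} z" and "0 < b"
    and unb: "filterlim (\<lambda>t. norm (z t)) at_top (at_left b)"
  shows "blows_up_at H (z 0) z b"
  unfolding blows_up_at_def
proof (intro conjI notI; (elim exE conjE)?)
  fix I w
  assume I: "is_interval I" "I \<subseteq> {0..}" "{0..<b} \<subset> I" and w: "ham_solution H (z 0) I w"
    and eq: "\<forall>t\<in>{0..<b}. w t = z t"
  \<comment> \<open>The proper inclusion yields a point outside \<open>{0..<b}\<close>, and an
    interval containing it and 0 contains \<open>b\<close>.\<close>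
  obtain c where "c \<in> I" "c \<ge> b"
    using I by force
  moreover have "0 \<in> I"
    using I \<open>0 < b\<close> by auto
  ultimately have sub: "{0..b} \<subseteq> I"
    using I(1) mem_is_interval_1_I[of I 0 c] by (auto simp: subset_iff)
  have "continuous_on {0..b} w"
    using w sub by (rule ham_solution_continuous_on)
  then have "bounded (w ` {0..b})"
    by (intro compact_imp_bounded compact_continuous_image) auto
  then obtain B where B: "\<And>t. t \<in> {0..b} \<Longrightarrow> norm (w t) \<le> B"
    unfolding bounded_iff by (metis imageI)
  have "\<forall>\<^sub>F t in at_left b. t \<in> {0<..<b}"
    using \<open>0 < b\<close> by (rule eventually_at_left_real)
  moreover have "\<forall>\<^sub>F t in at_left b. norm (z t) \<ge> B + 1"
    using unb by (auto simp: filterlim_at_top)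
  ultimately have "\<forall>\<^sub>F t in at_left b. False"
  proof eventually_elim
    case (elim t)
    then show False
      using B[of t] eq by simp
  qed
  then show False
    by simp
qed fact+

section \<open>The Hamiltonian in polar coordinates\<close>

locale driven_hamiltonian =
  fixes T T\<^sub>F \<alpha> \<beta> \<sigma> \<epsilon> L :: real and f :: "real \<Rightarrow> real \<Rightarrow> real" and g :: "real \<Rightarrow> real"
  assumes T\<^sub>F_pos: "0 < T\<^sub>F" and T\<^sub>F_le: "T\<^sub>F \<le> T"
    and \<alpha>: "1 < \<alpha>" and \<beta>: "0 < \<beta>" and \<sigma>: "T\<^sub>F powr (\<beta> - 1) \<le> \<sigma>"
    and f_smooth: "smooth_on ({0..<T\<^sub>F} \<times> UNIV) (\<lambda>(t, u). f t u)"
    and f_bound: "t \<in> {0..<T\<^sub>F} \<Longrightarrow> \<bar>f t u\<bar> \<le> \<epsilon>"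
    and f_periodic: "t \<in> {0..<T\<^sub>F} \<Longrightarrow> f t (u + 2 * pi) = f t u"
    and f_deriv_0: "t \<in> {0..<T\<^sub>F} \<Longrightarrow> deriv (f t) 0 = - deriv (rho_star T\<^sub>F \<beta> \<sigma>) t"
    and f_deriv_lower: "t \<in> {0..<T\<^sub>F} \<Longrightarrow> - deriv (rho_star T\<^sub>F \<beta> \<sigma>) t \<le> deriv (f t) u"
    and f_deriv_upper: "t \<in> {0..<T\<^sub>F} \<Longrightarrow> deriv (f t) u \<le> \<beta> / T\<^sub>F"
    and g_smooth: "smooth_on UNIV g"
    and g_range: "g x \<in> {0..1}"
    and g_supp: "supp g = {-1/2..1/2}"
    and g_0: "g 0 = 1" and g_deriv_0: "deriv g 0 = 0"
    and g_deriv_bound: "\<bar>deriv g x\<bar> \<le> L"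
begin

abbreviation "\<theta>s \<equiv> theta_star T\<^sub>F \<alpha> \<beta> \<sigma>"
abbreviation "\<rho>s \<equiv> rho_star T\<^sub>F \<beta> \<sigma>"
abbreviation "H \<equiv> hamiltonian T T\<^sub>F \<alpha> \<beta> \<sigma> f g"

section \<open>The driving curves \<open>\<rho>s\<close> and \<open>\<theta>s\<close>\<close>

lemma \<sigma>_pos: "\<sigma> > 0"
  using \<sigma> T\<^sub>F_pos powr_gt_zero[of T\<^sub>F "\<beta> - 1"] by linarith

lemma \<epsilon>_nonneg: "\<epsilon> \<ge> 0"
  using f_bound[of 0 0] T\<^sub>F_pos abs_ge_zero[of "f 0 0"] by simp

lemma L_nonneg: "L \<ge> 0"
  using g_deriv_bound[of 0] abs_ge_zero[of "deriv g 0"] by linarith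

text \<open>The lower bound on \<open>\<sigma>\<close> says that \<open>\<sigma> * T\<^sub>F\<close>
  is at least \<open>T\<^sub>F powr \<beta>\<close>. As a consequence the bump \<open>g\<close>, of
  radius 1/2 around \<open>\<rho>s t\<close>, never reaches actions below 1/2, so the origin stays
  untouched.\<close>

lemma \<rho>s_ge_1:
  assumes "t \<in> {0..<T\<^sub>F}"
  shows "\<rho>s t \<ge> 1"
proof -
  have "(T\<^sub>F - t) powr \<beta> \<le> T\<^sub>F powr \<beta>"
    using assms \<beta> by (intro powr_mono2) auto
  also have "\<dots> = T\<^sub>F powr (\<beta> - 1) * T\<^sub>F"
    using T\<^sub>F_pos by (simp add: powr_diff)
  also have "\<dots> \<le> \<sigma> * T\<^sub>F"
    using \<sigma> T\<^sub>F_pos by simp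
  finally show ?thesis
    using assms by (simp add: rho_star_def le_divide_eq)
qed

lemma \<rho>s_has_real_derivative:
  assumes "t \<in> {0..<T\<^sub>F}"
  shows "(\<rho>s has_real_derivative deriv \<rho>s t) (at t)"
proof -
  have "\<rho>s field_differentiable (at t)"
    unfolding rho_star_def[abs_def] field_differentiable_def
    using assms by (auto intro!: derivative_eq_intros exI)
  then show ?thesis
    by (simp add: field_differentiable_derivI)
qed

lemma continuous_on_\<rho>s: "continuous_on {0..<T\<^sub>F} \<rho>s"
  using DERIV_isCont[OF \<rho>s_has_real_derivative] continuous_at_imp_continuous_on by blast

lemma deriv_\<rho>s_nonneg: "t \<in> {0..<T\<^sub>F} \<Longrightarrow> deriv \<rho>s t \<ge> 0"
  using \<sigma>_pos \<beta> T\<^sub>F_pos by (simp add: deriv_rho_star)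

lemma deriv_\<rho>s_mono:
  assumes "0 \<le> s" "s \<le> t" "t < T\<^sub>F"
  shows "deriv \<rho>s s \<le> deriv \<rho>s t"
  using assms \<sigma>_pos \<beta> T\<^sub>F_pos
  by (auto simp: deriv_rho_star intro!: divide_left_mono powr_mono2 mult_pos_pos)

lemma \<rho>s_at_top: "filterlim \<rho>s at_top (at_left T\<^sub>F)"
proof -
  have "filterlim (\<lambda>t. T\<^sub>F - t) (at_right 0) (at_left T\<^sub>F)"
    by (intro filterlim_at_withinI) (auto intro!: tendsto_eq_intros simp: eventually_at_filter)
  moreover have "filterlim (\<lambda>x. x powr \<beta>) (at_right 0) (at_right 0)"
    using \<beta> by (intro filterlim_at_withinI)
      (auto intro!: tendsto_eq_intros simp: eventually_at_filter)
  ultimately have "filterlim (\<lambda>t. (T\<^sub>F - t) powr \<beta>) (at_right 0) (at_left T\<^sub>F)"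
    by (rule filterlim_compose[rotated])
  then have "filterlim (\<lambda>t. inverse ((T\<^sub>F - t) powr \<beta>)) at_top (at_left T\<^sub>F)"
    by (rule filterlim_compose[OF filterlim_inverse_at_top_right])
  then have "filterlim (\<lambda>t. \<sigma> * T\<^sub>F * inverse ((T\<^sub>F - t) powr \<beta>)) at_top (at_left T\<^sub>F)"
    using \<sigma>_pos T\<^sub>F_pos by (intro filterlim_tendsto_pos_mult_at_top[OF tendsto_const]) auto
  then show ?thesis
    by (simp add: rho_star_def[abs_def] divide_inverse)
qed

lemma continuous_on_speed: "continuous_on {0..<T\<^sub>F} (\<lambda>s. (T\<^sub>F - s) powr (- \<beta> * (\<alpha> - 1)))"
  by (intro continuous_intros) auto

text \<open>This identifies the integrand of \<open>theta_star\<close>: up to the factor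
  \<open>\<alpha>\<close>, it is the angular speed of the unperturbed system at action
  \<open>\<rho>s t\<close>.\<close>

lemma \<rho>s_powr:
  assumes "t \<in> {0..<T\<^sub>F}"
  shows "\<rho>s t powr (\<alpha> - 1) = (\<sigma> * T\<^sub>F) powr (\<alpha> - 1) * (T\<^sub>F - t) powr (- \<beta> * (\<alpha> - 1))"
  using assms \<sigma>_pos T\<^sub>F_pos
  by (simp add: rho_star_def powr_divide powr_powr powr_minus_divide)

lemma \<theta>s_has_real_derivative:
  assumes "t \<in> {0..<T\<^sub>F}"
  shows "(\<theta>s has_real_derivative \<alpha> * \<rho>s t powr (\<alpha> - 1)) (at t within {0..<T\<^sub>F})"
proof -
  have "((\<lambda>t. integral {0..t} (\<lambda>s. (T\<^sub>F - s) powr (- \<beta> * (\<alpha> - 1)))) has_real_derivative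
      (T\<^sub>F - t) powr (- \<beta> * (\<alpha> - 1))) (at t within {0..<T\<^sub>F})"
    using integral_has_vector_derivative_atLeastLessThan[OF continuous_on_speed assms]
    by (simp add: has_real_derivative_iff_has_vector_derivative)
  then show ?thesis
    unfolding theta_star_def[abs_def] using \<rho>s_powr[OF assms]
    by (auto intro!: derivative_eq_intros)
qed

lemma continuous_on_\<theta>s: "continuous_on {0..<T\<^sub>F} \<theta>s"
  using \<theta>s_has_real_derivative by (rule DERIV_continuous_on)

lemma g_has_real_derivative: "(g has_real_derivative deriv g x) (at x)"
  using g_smooth by (rule smooth_on_UNIV_real)

lemma f_has_real_derivative: "t \<in> {0..<T\<^sub>F} \<Longrightarrow> (f t has_real_derivative deriv (f t) u) (at u)"
  using f_smooth by (rule has_real_derivative_section)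

lemma deriv_f_periodic:
  assumes "t \<in> {0..<T\<^sub>F}"
  shows "deriv (f t) (u + 2 * pi) = deriv (f t) u"
proof -
  have "((\<lambda>u. f t (u + 2 * pi)) has_real_derivative deriv (f t) (u + 2 * pi)) (at u)"
    using f_has_real_derivative[OF assms, of "u + 2 * pi"] by (simp add: DERIV_shift)
  then have "(f t has_real_derivative deriv (f t) (u + 2 * pi)) (at u)"
    by (simp add: f_periodic[OF assms])
  then show ?thesis
    using DERIV_imp_deriv by metis
qed

lemma g_eq_0: "\<bar>x\<bar> > 1/2 \<Longrightarrow> g x = 0" "\<bar>x\<bar> > 1/2 \<Longrightarrow> deriv g x = 0"
  by (rule not_in_supp; simp add: g_supp; linarith)+

section \<open>The partial derivatives of the Hamiltonian, for times in the first period\<close>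

definition dH_rho :: "real \<Rightarrow> real^2 \<Rightarrow> real" where
  "dH_rho t z = \<alpha> * action z powr (\<alpha> - 1) +
     (if t < T\<^sub>F then f t (angle z - \<theta>s t) * deriv g (action z - \<rho>s t) else 0)"

definition dH_theta :: "real \<Rightarrow> real^2 \<Rightarrow> real" where
  "dH_theta t z = (if t < T\<^sub>F then deriv (f t) (angle z - \<theta>s t) * g (action z - \<rho>s t) else 0)"

lemma dH_theta_eq_0: "t \<ge> 0 \<Longrightarrow> action z < 1/2 \<Longrightarrow> dH_theta t z = 0"
  using \<rho>s_ge_1[of t] g_eq_0(1)[of "action z - \<rho>s t"] by (auto simp: dH_theta_def)

lemma H_eq:
  assumes "t \<in> {0..<T}" "z \<noteq> 0"
  shows "H t z = action z powr \<alpha> +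
     (if t < T\<^sub>F then f t (angle z - \<theta>s t) * g (action z - \<rho>s t) else 0)"
  using assms by (simp add: hamiltonian_def K_def Let_def rmod_idem)

text \<open>Chain rule in polar coordinates: the gradient of the action is \<open>z\<close>, that of
  a branch of the angle is \<open>J *v z\<close> divided by \<open>(norm z)\<^sup>2\<close>. The
  origin, where there is no angle, is treated by a direct estimate.\<close>

lemma GDERIV_H:
  assumes t: "t \<in> {0..<T}"
  shows "GDERIV (H t) z :> dH_rho t z *\<^sub>R z + (dH_theta t z / (norm z)\<^sup>2) *\<^sub>R (J *v z)"
proof (cases "z = 0")
  case True
  \<comment> \<open>At the origin the claimed gradient is 0, both of its vectors being 0. The
    Hamiltonian is squeezed between 0 and the square of the norm.\<close>
  have "((H t) has_derivative (\<lambda>h. 0)) (at 0 within UNIV)"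
  proof (rule has_derivativeI_sandwich)
    show "(norm \<longlongrightarrow> 0) (at (0 :: real^2) within UNIV)"
      by (rule tendsto_norm_zero) (rule tendsto_ident_at)
    fix y :: "real^2" assume y: "y \<noteq> 0" "dist y 0 < 1"
    have small: "action y < 1/2"
      using y(2) by (simp add: action_def power_less_one_iff)
    \<comment> \<open>Since \<open>\<rho>s t\<close> is at least 1, the bump vanishes at actions
      below 1/2 and only the power of the action is left.\<close>
    then have "H t y = action y powr \<alpha>"
      using H_eq[OF t y(1)] \<rho>s_ge_1[of t] g_eq_0(1)[of "action y - \<rho>s t"] t by auto
    also have "\<dots> \<le> action y powr 1"
      using small \<alpha> by (intro powr_mono') auto
    also have "action y powr 1 \<le> norm y * norm y"
      by (simp add: action_def power2_eq_square)
    finally have "H t y \<le> norm y * norm y" "H t y \<ge> 0"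
      using \<open>H t y = _\<close> by auto
    then show "norm (H t y - H t 0 - 0) / norm (y - 0) \<le> norm y"
      using y by (simp add: hamiltonian_def divide_le_eq)
  qed auto
  then show ?thesis
    using True by (simp add: gderiv_def)
next
  case False
  let ?\<phi> = "angle_near (angle z)"
  have pw: "GDERIV (\<lambda>w. action w powr \<alpha>) z :> (\<alpha> * action z powr (\<alpha> - 1)) *\<^sub>R z"
    by (rule GDERIV_DERIV_compose[OF GDERIV_action])
      (use action_pos[OF False] in \<open>auto intro!: derivative_eq_intros simp: powr_diff\<close>)
  \<comment> \<open>The branch at \<open>z\<close> replaces \<open>angle\<close>, which may jump at
    \<open>z\<close>; by periodicity of \<open>f t\<close> the resulting function agrees with
    \<open>H t\<close> off the origin.\<close>
  have "GDERIV (\<lambda>w. action w powr \<alpha> +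
      (if t < T\<^sub>F then f t (?\<phi> w - \<theta>s t) * g (action w - \<rho>s t) else 0)) z
      :> dH_rho t z *\<^sub>R z + (dH_theta t z / (norm z)\<^sup>2) *\<^sub>R (J *v z)"
  proof (cases "t < T\<^sub>F")
    case True
    then have tF: "t \<in> {0..<T\<^sub>F}"
      using t by simp
    have "GDERIV (\<lambda>w. f t (?\<phi> w - \<theta>s t)) z
        :> deriv (f t) (angle z - \<theta>s t) *\<^sub>R ((1 / (norm z)\<^sup>2) *\<^sub>R (J *v z))"
      by (rule GDERIV_DERIV_compose[OF GDERIV_angle_near[OF False]])
        (use f_has_real_derivative[OF tF, of "angle z - \<theta>s t"] DERIV_shift[of "f t" _ "angle z" "- \<theta>s t"] in simp)
    moreover have "GDERIV (\<lambda>w. g (action w - \<rho>s t)) z :> deriv g (action z - \<rho>s t) *\<^sub>R z"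
      by (rule GDERIV_DERIV_compose[OF GDERIV_action])
        (use g_has_real_derivative[of "action z - \<rho>s t"] DERIV_shift[of g _ "action z" "- \<rho>s t"] in simp)
    ultimately have "GDERIV (\<lambda>w. f t (?\<phi> w - \<theta>s t) * g (action w - \<rho>s t)) z :>
        f t (?\<phi> z - \<theta>s t) *\<^sub>R (deriv g (action z - \<rho>s t) *\<^sub>R z) +
        g (action z - \<rho>s t) *\<^sub>R (deriv (f t) (angle z - \<theta>s t) *\<^sub>R ((1 / (norm z)\<^sup>2) *\<^sub>R (J *v z)))"
      by (rule GDERIV_mult)
    from GDERIV_add[OF pw this] show ?thesis
      using True by (simp add: dH_rho_def dH_theta_def algebra_simps)
  next
    case False
    then show ?thesis
      using pw by (simp add: dH_rho_def dH_theta_def)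
  qed
  then show ?thesis
    unfolding gderiv_def
  proof (rule has_derivative_transform_within_open)
    show "open (- {0 :: real^2})"
      by (intro open_Compl closed_singleton)
    show "z \<in> - {0}" using False by simp
    fix w :: "real^2" assume "w \<in> - {0}"
    then show "action w powr \<alpha> +
        (if t < T\<^sub>F then f t (?\<phi> w - \<theta>s t) * g (action w - \<rho>s t) else 0) = H t w"
      using t periodic_angle_near[of "f t" w "angle z" "\<theta>s t"] f_periodic[of t] by (simp add: H_eq)
  qed
qed

text \<open>Since \<open>J\<close> squares to minus the identity, it turns the angular part of the
  gradient into the radial part of the velocity.\<close>

lemma J_gradient_H:
  assumes "t \<in> {0..<T}"
  shows "J *v gradient (H t) z = dH_rho t z *\<^sub>R (J *v z) - (dH_theta t z / (norm z)\<^sup>2) *\<^sub>R z"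
  by (simp add: gradient_eq[OF GDERIV_H[OF assms]] vec_eq_iff forall_2 algebra_simps)

text \<open>The integrand of \<open>rot\<close> is the angular speed: \<open>J *v z\<close> is
  orthogonal to \<open>z\<close> and has the same norm.\<close>

lemma J_gradient_H_inner_J:
  assumes "t \<in> {0..<T}" "z \<noteq> 0"
  shows "((J *v gradient (H t) z) \<bullet> (J *v z)) / (norm z)\<^sup>2 = dH_rho t z"
  using assms by (simp add: J_gradient_H inner_diff_left power2_norm_eq_inner)

text \<open>As \<open>z\<close> is the gradient of \<open>action\<close>, this is the rate of change
  of the action along solutions. At the origin it holds because \<open>dH_theta\<close> vanishes for
  small actions.\<close>

lemma inner_J_gradient_H:
  assumes "t \<in> {0..<T}"
  shows "z \<bullet> (J *v gradient (H t) z) = - dH_theta t z"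
proof (cases "z = 0")
  case True
  then show ?thesis
    using assms dH_theta_eq_0[of t 0] by simp
next
  case False
  then show ?thesis
    using assms by (simp add: J_gradient_H inner_diff_right power2_norm_eq_inner)
qed

text \<open>The times are covered by two relatively open sets: \<open>U\<close>, where the point is
  nonzero and the periodic function of its angle is continuous, and \<open>V\<close>, where the
  action is below 1/2 and the cutoff makes the product 0. The factor \<open>m\<close> only has to be
  continuous off the zeros of \<open>z\<close>, which admits the reciprocal of
  \<open>(norm (z t))\<^sup>2\<close>.\<close>

lemma continuous_on_cutoff:
  fixes h :: "real \<Rightarrow> real \<Rightarrow> real" and k m :: "real \<Rightarrow> real"
  assumes h: "continuous_on ({0..<T\<^sub>F} \<times> UNIV) (\<lambda>(t, u). h t u)"
    and per: "\<And>t u. t \<in> {0..<T\<^sub>F} \<Longrightarrow> h t (u + 2 * pi) = h t u"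
    and k: "continuous_on UNIV k" and k0: "\<And>x :: real. \<bar>x\<bar> > 1/2 \<Longrightarrow> k x = 0"
    and S: "S \<subseteq> {0..<T\<^sub>F}" and z: "continuous_on S z"
    and m: "continuous_on {t \<in> S. z t \<noteq> 0} m"
  shows "continuous_on S (\<lambda>t. h t (angle (z t) - \<theta>s t) * k (action (z t) - \<rho>s t) * m t)"
proof -
  let ?F = "\<lambda>t. h t (angle (z t) - \<theta>s t) * k (action (z t) - \<rho>s t) * m t"
  define U where "U = {t \<in> S. z t \<noteq> 0}"
  define V where "V = {t \<in> S. action (z t) < 1/2}"
  have SUV: "S = U \<union> V"
    by (auto simp: U_def V_def action_def)
  have "U = S \<inter> z -` (- {0})"
    by (auto simp: U_def)
  then have "openin (top_of_set S) U"
    using continuous_openin_preimage_gen[OF z, of "- {0}"] open_Compl[OF closed_singleton] by metis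
  moreover have "V = S \<inter> (\<lambda>t. action (z t)) -` {..<1/2}"
    by (auto simp: V_def)
  then have "openin (top_of_set S) V"
    using continuous_openin_preimage_gen[OF continuous_on_action[OF z], of "{..<1/2}"] by simp
  moreover have "continuous_on U ?F"
  proof (intro continuous_on_mult)
    have US: "U \<subseteq> S" "U \<subseteq> {0..<T\<^sub>F}"
      using S by (auto simp: U_def)
    show "continuous_on U (\<lambda>t. h t (angle (z t) - \<theta>s t))"
    proof (rule continuous_on_periodic_angle)
      show "continuous_on (U \<times> UNIV) (\<lambda>(t, u). h t u)"
        by (rule continuous_on_subset[OF h]) (use US in auto)
      show "continuous_on U z" "continuous_on U \<theta>s"
        using US z continuous_on_\<theta>s continuous_on_subset by blast+
    qed (use US per in \<open>auto simp: U_def\<close>)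
    have "continuous_on U (\<lambda>t. action (z t) - \<rho>s t)"
      using US continuous_on_subset[OF continuous_on_action[OF z]] continuous_on_subset[OF continuous_on_\<rho>s]
      by (intro continuous_on_diff) blast+
    then show "continuous_on U (\<lambda>t. k (action (z t) - \<rho>s t))"
      by (rule continuous_on_compose2[OF k]) auto
    show "continuous_on U m"
      using m by (simp add: U_def)
  qed
  moreover have "continuous_on V ?F"
  proof (rule continuous_on_eq)
    show "continuous_on V (\<lambda>_. 0)" by simp
    fix t assume "t \<in> V"
    then have "action (z t) < 1/2" "\<rho>s t \<ge> 1"
      using S by (auto simp: V_def intro!: \<rho>s_ge_1)
    then show "0 = ?F t"
      by (simp add: k0)
  qed
  ultimately show ?thesis
    unfolding SUV by (intro continuous_on_Un_local_open)
qed

lemma continuous_on_action_powr: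
  assumes "continuous_on S z"
  shows "continuous_on S (\<lambda>t. \<alpha> * action (z t) powr (\<alpha> - 1))"
  using \<alpha> by (intro continuous_intros continuous_on_powr' continuous_on_action assms) auto

lemma continuous_on_dH_rho:
  assumes S: "S \<subseteq> {0..<T\<^sub>F} \<or> S \<subseteq> {T\<^sub>F..<T}" and z: "continuous_on S z"
  shows "continuous_on S (\<lambda>t. dH_rho t (z t))"
  using S
proof
  assume S: "S \<subseteq> {0..<T\<^sub>F}"
  have "continuous_on S (\<lambda>t. \<alpha> * action (z t) powr (\<alpha> - 1) +
      f t (angle (z t) - \<theta>s t) * deriv g (action (z t) - \<rho>s t) * 1)"
    using S by (intro continuous_on_add continuous_on_action_powr z continuous_on_cutoff
        continuous_on_section f_smooth f_periodic smooth_on_UNIV_real g_smooth g_eq_0 continuous_on_const) auto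
  then show ?thesis
    by (rule continuous_on_eq) (use S in \<open>auto simp: dH_rho_def\<close>)
next
  assume "S \<subseteq> {T\<^sub>F..<T}"
  then show ?thesis
    by (intro continuous_on_eq[OF continuous_on_action_powr[OF z]]) (auto simp: dH_rho_def)
qed

lemma continuous_on_dH_theta:
  assumes S: "S \<subseteq> {0..<T\<^sub>F} \<or> S \<subseteq> {T\<^sub>F..<T}" and z: "continuous_on S z"
  shows "continuous_on S (\<lambda>t. dH_theta t (z t) / (norm (z t))\<^sup>2)"
  using S
proof
  assume S: "S \<subseteq> {0..<T\<^sub>F}"
  have g: "continuous_on UNIV g"
    using g_has_real_derivative by (rule DERIV_continuous_on)
  have "continuous_on {t \<in> S. z t \<noteq> 0} (\<lambda>t. 1 / (norm (z t))\<^sup>2)"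
    by (intro continuous_intros continuous_on_subset[OF z]) auto
  then have "continuous_on S (\<lambda>t. deriv (f t) (angle (z t) - \<theta>s t) * g (action (z t) - \<rho>s t) *
      (1 / (norm (z t))\<^sup>2))"
    using S by (intro z g continuous_on_cutoff
        continuous_on_deriv_section f_smooth deriv_f_periodic g_eq_0) auto
  then show ?thesis
    by (rule continuous_on_eq) (use S in \<open>auto simp: dH_theta_def\<close>)
next
  assume "S \<subseteq> {T\<^sub>F..<T}"
  then show ?thesis
    by (intro continuous_on_eq[OF continuous_on_const[of S 0]]) (auto simp: dH_theta_def)
qed

text \<open>The perturbation may be discontinuous at \<open>T\<^sub>F\<close>, so the times have to
  lie on one side of it.\<close>

lemma continuous_on_rhs:
  assumes S: "S \<subseteq> {0..<T\<^sub>F} \<or> S \<subseteq> {T\<^sub>F..<T}" and z: "continuous_on S z"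
  shows "continuous_on S (\<lambda>t. J *v gradient (H t) (z t))"
proof (rule continuous_on_eq)
  show "continuous_on S (\<lambda>t. dH_rho t (z t) *\<^sub>R (J *v z t) - (dH_theta t (z t) / (norm (z t))\<^sup>2) *\<^sub>R z t)"
    by (intro continuous_on_diff continuous_on_scaleR continuous_on_dH_rho[OF S z]
        continuous_on_dH_theta[OF S z] z bounded_linear.continuous_on[OF linear_J])
qed (use S T\<^sub>F_pos T\<^sub>F_le J_gradient_H in auto)

lemma action_has_real_derivative:
  assumes sol: "ham_solution H z0 {0..<b} z" and ac: "0 \<le> a" "c \<le> b"
    and S: "{a..<c} \<subseteq> {0..<T\<^sub>F} \<or> {a..<c} \<subseteq> {T\<^sub>F..<T}" and t: "t \<in> {a..<c}"
  shows "((\<lambda>t. action (z t)) has_real_derivative - dH_theta t (z t)) (at t within {a..<c})"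
proof -
  have "continuous_on {0..<b} z"
    using sol by (rule ham_solution_continuous_on_half_open)
  then have "continuous_on {a..<c} z"
    by (rule continuous_on_subset) (use ac in auto)
  then have "(z has_vector_derivative J *v gradient (H t) (z t)) (at t within {a..<c})"
    using ham_solution_has_vector_derivative[OF sol ac _ t] continuous_on_rhs[OF S] by blast
  then have "(z has_derivative (\<lambda>h. h *\<^sub>R (J *v gradient (H t) (z t)))) (at t within {a..<c})"
    by (simp add: has_vector_derivative_def)
  moreover have "(action has_derivative (\<lambda>h. h \<bullet> z t)) (at (z t))"
    using GDERIV_action by (simp add: gderiv_def)
  ultimately have "((\<lambda>t. action (z t)) has_derivative (\<lambda>h. (h *\<^sub>R (J *v gradient (H t) (z t))) \<bullet> z t))
      (at t within {a..<c})"
    by (rule has_derivative_compose)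
  moreover have "t \<in> {0..<T}"
    using S t T\<^sub>F_pos T\<^sub>F_le by auto
  then have "(\<lambda>h. (h *\<^sub>R (J *v gradient (H t) (z t))) \<bullet> z t) = (*) (- dH_theta t (z t))"
    using inner_J_gradient_H[of t "z t"] by (auto simp: inner_commute)
  ultimately show ?thesis
    by (simp only: has_field_derivative_def)
qed

text \<open>The perturbation enters the angular speed only through \<open>f\<close> times the
  derivative of \<open>g\<close>; over a bounded time it changes the rotation by a bounded
  amount.\<close>

lemma abs_dH_rho_le:
  assumes "0 \<le> t"
  shows "\<bar>dH_rho t z - \<alpha> * action z powr (\<alpha> - 1)\<bar> \<le> \<epsilon> * L"
  using assms \<epsilon>_nonneg L_nonneg f_bound[of t] g_deriv_bound
  by (auto simp: dH_rho_def abs_mult intro!: mult_mono)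

text \<open>The tangential part is the angular speed times \<open>norm z\<close>, which is the root
  of twice the action. The radial part is \<open>dH_theta t z\<close> divided by
  \<open>norm z\<close>, and \<open>norm z\<close> is at least 1 unless \<open>dH_theta t z\<close>
  vanishes.\<close>

lemma norm_rhs_le:
  assumes t: "t \<in> {0..<T}" and R: "action z \<le> R" and D: "\<bar>dH_theta t z\<bar> \<le> D"
  shows "norm (J *v gradient (H t) z) \<le> (\<alpha> * R powr (\<alpha> - 1) + \<epsilon> * L) * sqrt (2 * R) + D"
proof -
  have R0: "R \<ge> 0" and D0: "D \<ge> 0"
    using R D action_nonneg[of z] by linarith+
  have "norm z = sqrt (2 * action z)"
    by (simp add: action_def)
  then have z: "norm z \<le> sqrt (2 * R)"
    using R by simp
  have "action z powr (\<alpha> - 1) \<le> R powr (\<alpha> - 1)"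
    using R \<alpha> by (intro powr_mono2) auto
  then have "\<alpha> * action z powr (\<alpha> - 1) \<le> \<alpha> * R powr (\<alpha> - 1)"
    using \<alpha> by simp
  then have "\<bar>dH_rho t z\<bar> \<le> \<alpha> * R powr (\<alpha> - 1) + \<epsilon> * L"
    using abs_dH_rho_le[of t z] t \<alpha> powr_ge_zero[of "action z" "\<alpha> - 1"]
      mult_nonneg_nonneg[of \<alpha> "action z powr (\<alpha> - 1)"] by (smt (verit) atLeastLessThan_iff)
  then have 1: "\<bar>dH_rho t z\<bar> * norm z \<le> (\<alpha> * R powr (\<alpha> - 1) + \<epsilon> * L) * sqrt (2 * R)"
    using z by (intro mult_mono) auto
  have 2: "\<bar>dH_theta t z / (norm z)\<^sup>2\<bar> * norm z \<le> D"
  proof (cases "action z < 1/2")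
    case True
    then show ?thesis
      using t D0 by (simp add: dH_theta_eq_0)
  next
    case False
    then have "(norm z)\<^sup>2 \<ge> 1"
      by (simp add: action_def)
    then have "norm z \<ge> 1"
      using power_less_one_iff[of "norm z" 2] by (force simp: not_less)
    then have "\<bar>dH_theta t z\<bar> * 1 \<le> D * norm z"
      using D D0 by (intro mult_mono) auto
    moreover have "\<bar>dH_theta t z / (norm z)\<^sup>2\<bar> * norm z = \<bar>dH_theta t z\<bar> / norm z"
      by (simp add: abs_divide power2_eq_square)
    ultimately show ?thesis
      using \<open>norm z \<ge> 1\<close> D0 by (simp add: divide_le_eq)
  qed
  show ?thesis
    unfolding J_gradient_H[OF t]
    by (rule order_trans[OF norm_triangle_ineq4]) (use 1 2 in simp)
qed

lemma not_blows_up_at_if_action_bounded: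
  assumes sol: "ham_solution H z0 {0..<b} z" and c: "0 \<le> c" "c < b"
    and S: "{c..<b} \<subseteq> {0..<T\<^sub>F} \<or> {c..<b} \<subseteq> {T\<^sub>F..<T}"
    and R: "\<And>t. t \<in> {c..<b} \<Longrightarrow> action (z t) \<le> R"
    and D: "\<And>t. t \<in> {c..<b} \<Longrightarrow> \<bar>dH_theta t (z t)\<bar> \<le> D"
  shows "\<not> blows_up_at H z0 z b"
proof (rule not_blows_up_at_if_bounded[OF sol c])
  have "continuous_on {0..<b} z"
    using sol by (rule ham_solution_continuous_on_half_open)
  then have "continuous_on {c..<b} z"
    by (rule continuous_on_subset) (use c in auto)
  then show "continuous_on {c..<b} (\<lambda>r. J *v gradient (H r) (z r))"
    by (rule continuous_on_rhs[OF S])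
  fix r assume r: "r \<in> {c..<b}"
  then have "r \<in> {0..<T}"
    using S T\<^sub>F_pos T\<^sub>F_le by auto
  then show "norm (J *v gradient (H r) (z r)) \<le> (\<alpha> * R powr (\<alpha> - 1) + \<epsilon> * L) * sqrt (2 * R) + D"
    using R[OF r] D[OF r] by (rule norm_rhs_le)
qed

section \<open>Rotation of solutions that blow up\<close>

lemma \<theta>s_0 [simp]: "\<theta>s 0 = 0"
  by (simp add: theta_star_def)

text \<open>The speed of \<open>\<theta>s\<close> dominates a positive multiple of
  \<open>1 / (T\<^sub>F - t)\<close>, so \<open>\<theta>s\<close> grows at least
  logarithmically.\<close>

lemma \<theta>s_at_top:
  assumes "\<beta> * (\<alpha> - 1) \<ge> 1"
  shows "filterlim \<theta>s at_top (at_left T\<^sub>F)"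
proof -
  \<comment> \<open>The exponent of the last factor is nonpositive, so that factor is the least
    value of \<open>(T\<^sub>F - r) powr (1 - \<beta> * (\<alpha> - 1))\<close>, attained at
    \<open>r = 0\<close>.\<close>
  define \<kappa> where "\<kappa> = \<alpha> * (\<sigma> * T\<^sub>F) powr (\<alpha> - 1) * T\<^sub>F powr (1 - \<beta> * (\<alpha> - 1))"
  have \<kappa>: "\<kappa> > 0"
    using \<alpha> \<sigma>_pos T\<^sub>F_pos by (simp add: \<kappa>_def)
  have low: "\<theta>s t \<ge> \<kappa> * (ln T\<^sub>F - ln (T\<^sub>F - t))" if t: "t \<in> {0..<T\<^sub>F}" for t
  proof -
    have "- \<kappa> * ln (T\<^sub>F - t) - \<theta>s t \<le> - \<kappa> * ln (T\<^sub>F - 0) - \<theta>s 0"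
    proof (rule nonincreasing_of_derivative[of 0 T\<^sub>F "\<lambda>t. - \<kappa> * ln (T\<^sub>F - t) - \<theta>s t"
          "\<lambda>t. \<kappa> / (T\<^sub>F - t) - \<alpha> * \<rho>s t powr (\<alpha> - 1)"])
      fix r assume r: "r \<in> {0..<T\<^sub>F}"
      show "((\<lambda>t. - \<kappa> * ln (T\<^sub>F - t) - \<theta>s t) has_real_derivative
          \<kappa> / (T\<^sub>F - r) - \<alpha> * \<rho>s r powr (\<alpha> - 1)) (at r within {0..<T\<^sub>F})"
        using r by (auto intro!: derivative_eq_intros \<theta>s_has_real_derivative)
      have "T\<^sub>F powr (1 - \<beta> * (\<alpha> - 1)) \<le> (T\<^sub>F - r) powr (1 - \<beta> * (\<alpha> - 1))"
        using r assms by (intro powr_mono2') auto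
      also have "\<dots> = (T\<^sub>F - r) * (T\<^sub>F - r) powr (- \<beta> * (\<alpha> - 1))"
        using r by (simp add: powr_diff powr_minus_divide)
      finally have "T\<^sub>F powr (1 - \<beta> * (\<alpha> - 1)) / (T\<^sub>F - r) \<le> (T\<^sub>F - r) powr (- \<beta> * (\<alpha> - 1))"
        using r by (simp add: divide_le_eq mult.commute)
      then have "\<alpha> * (\<sigma> * T\<^sub>F) powr (\<alpha> - 1) * (T\<^sub>F powr (1 - \<beta> * (\<alpha> - 1)) / (T\<^sub>F - r)) \<le>
          \<alpha> * (\<sigma> * T\<^sub>F) powr (\<alpha> - 1) * (T\<^sub>F - r) powr (- \<beta> * (\<alpha> - 1))"
        using \<alpha> by (intro mult_left_mono) auto
      then show "\<kappa> / (T\<^sub>F - r) - \<alpha> * \<rho>s r powr (\<alpha> - 1) \<le> 0"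
        by (simp add: \<rho>s_powr[OF r] \<kappa>_def mult.assoc)
    qed (use t in auto)
    then show ?thesis
      by (simp add: right_diff_distrib)
  qed
  have "filterlim (\<lambda>t. T\<^sub>F - t) (at_right 0) (at_left T\<^sub>F)"
    by (intro filterlim_at_withinI) (auto intro!: tendsto_eq_intros simp: eventually_at_filter)
  then have "filterlim (\<lambda>t. ln (T\<^sub>F - t)) at_bot (at_left T\<^sub>F)"
    by (rule filterlim_compose[OF ln_at_0])
  then have "filterlim (\<lambda>t. ln T\<^sub>F + (- ln (T\<^sub>F - t))) at_top (at_left T\<^sub>F)"
    by (intro filterlim_tendsto_add_at_top[OF tendsto_const]) (simp add: filterlim_uminus_at_top)
  then have "filterlim (\<lambda>t. \<kappa> * (ln T\<^sub>F - ln (T\<^sub>F - t))) at_top (at_left T\<^sub>F)"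
    using filterlim_tendsto_pos_mult_at_top[OF tendsto_const \<kappa>] by simp
  moreover have "\<forall>\<^sub>F t in at_left T\<^sub>F. t \<in> {0<..<T\<^sub>F}"
    using T\<^sub>F_pos by (rule eventually_at_left_real)
  then have "\<forall>\<^sub>F t in at_left T\<^sub>F. \<kappa> * (ln T\<^sub>F - ln (T\<^sub>F - t)) \<le> \<theta>s t"
    by eventually_elim (use low in auto)
  ultimately show ?thesis
    by (rule filterlim_at_top_mono)
qed

text \<open>Here the speed is integrable up to \<open>T\<^sub>F\<close>: adding the explicit power
  of \<open>T\<^sub>F - t\<close> gives a function with derivative 0. The bound is the value of that
  function at time 0.\<close>

lemma \<theta>s_bounded:
  assumes "\<beta> * (\<alpha> - 1) < 1"
  obtains B where "\<And>t. t \<in> {0..<T\<^sub>F} \<Longrightarrow> \<theta>s t \<le> B"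
proof
  let ?\<gamma> = "\<beta> * (\<alpha> - 1)"
  define \<kappa> where "\<kappa> = \<alpha> * (\<sigma> * T\<^sub>F) powr (\<alpha> - 1)"
  have \<kappa>: "\<kappa> \<ge> 0"
    using \<alpha> by (simp add: \<kappa>_def)
  fix t assume t: "t \<in> {0..<T\<^sub>F}"
  have "\<theta>s t + \<kappa> * (T\<^sub>F - t) powr (1 - ?\<gamma>) / (1 - ?\<gamma>) \<le> \<theta>s 0 + \<kappa> * (T\<^sub>F - 0) powr (1 - ?\<gamma>) / (1 - ?\<gamma>)"
  proof (rule nonincreasing_of_derivative[of 0 T\<^sub>F
        "\<lambda>t. \<theta>s t + \<kappa> * (T\<^sub>F - t) powr (1 - ?\<gamma>) / (1 - ?\<gamma>)" "\<lambda>_. 0"])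
    fix r assume r: "r \<in> {0..<T\<^sub>F}"
    have "((\<lambda>t. (T\<^sub>F - t) powr (1 - ?\<gamma>)) has_real_derivative
        (1 - ?\<gamma>) * (T\<^sub>F - r) powr (1 - ?\<gamma> - of_nat 1) * (0 - 1)) (at r)"
      using r by (intro DERIV_fun_powr DERIV_diff DERIV_const DERIV_ident) auto
    then have "((\<lambda>t. (T\<^sub>F - t) powr (1 - ?\<gamma>)) has_real_derivative
        - ((1 - ?\<gamma>) * (T\<^sub>F - r) powr (- \<beta> * (\<alpha> - 1)))) (at r within {0..<T\<^sub>F})"
      by (simp add: has_field_derivative_at_within)
    then have "((\<lambda>t. \<theta>s t + \<kappa> * (T\<^sub>F - t) powr (1 - ?\<gamma>) / (1 - ?\<gamma>)) has_real_derivative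
        \<alpha> * \<rho>s r powr (\<alpha> - 1) + \<kappa> * - ((1 - ?\<gamma>) * (T\<^sub>F - r) powr (- \<beta> * (\<alpha> - 1))) / (1 - ?\<gamma>))
        (at r within {0..<T\<^sub>F})"
      by (intro DERIV_add \<theta>s_has_real_derivative r DERIV_cdivide DERIV_cmult)
    then show "((\<lambda>t. \<theta>s t + \<kappa> * (T\<^sub>F - t) powr (1 - ?\<gamma>) / (1 - ?\<gamma>)) has_real_derivative 0)
        (at r within {0..<T\<^sub>F})"
      using assms by (simp add: \<rho>s_powr[OF r] \<kappa>_def mult.assoc)
  qed (use t in auto)
  moreover have "\<kappa> * (T\<^sub>F - t) powr (1 - ?\<gamma>) / (1 - ?\<gamma>) \<ge> 0"
    using \<kappa> assms by (intro divide_nonneg_nonneg mult_nonneg_nonneg) auto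
  ultimately show "\<theta>s t \<le> \<kappa> * T\<^sub>F powr (1 - ?\<gamma>) / (1 - ?\<gamma>)"
    by simp
qed

section \<open>Monotonicity of the action relative to \<open>\<rho>s\<close>, and the blow-up
  time\<close>

lemma dH_theta_ge:
  assumes "t \<in> {0..<T\<^sub>F}"
  shows "dH_theta t z \<ge> - deriv \<rho>s t"
proof -
  let ?g = "g (action z - \<rho>s t)"
  have g: "0 \<le> ?g" "?g \<le> 1"
    using g_range by auto
  \<comment> \<open>The left-hand side is nonpositive, so a factor between 0 and 1 can only increase
    it.\<close>
  have "- deriv \<rho>s t \<le> - deriv \<rho>s t * ?g"
    using deriv_\<rho>s_nonneg[OF assms] g by (simp add: mult_left_le)
  also have "\<dots> \<le> deriv (f t) (angle z - \<theta>s t) * ?g"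
    using f_deriv_lower[OF assms] g by (intro mult_right_mono)
  finally show ?thesis
    using assms by (simp add: dH_theta_def)
qed

lemma abs_dH_theta_le:
  assumes "t \<in> {0..<T\<^sub>F}"
  shows "\<bar>dH_theta t z\<bar> \<le> deriv \<rho>s t + \<beta> / T\<^sub>F"
proof -
  let ?g = "g (action z - \<rho>s t)"
  have g: "0 \<le> ?g" "?g \<le> 1"
    using g_range by auto
  have pos: "\<beta> / T\<^sub>F \<ge> 0"
    using \<beta> T\<^sub>F_pos by simp
  have "deriv (f t) (angle z - \<theta>s t) * ?g \<le> \<beta> / T\<^sub>F * ?g"
    using f_deriv_upper[OF assms] g by (intro mult_right_mono)
  also have "\<dots> \<le> \<beta> / T\<^sub>F"
    using pos g by (intro mult_left_le)
  finally have "dH_theta t z \<le> \<beta> / T\<^sub>F"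
    using assms by (simp add: dH_theta_def)
  then show ?thesis
    using dH_theta_ge[OF assms, of z] deriv_\<rho>s_nonneg[OF assms] pos by linarith
qed

text \<open>The derivative is \<open>- dH_theta t (z t) - deriv \<rho>s t\<close>, which
  \<open>dH_theta_ge\<close> makes nonpositive.\<close>

lemma action_minus_\<rho>s_nonincreasing:
  assumes sol: "ham_solution H z0 {0..<b} z" and st: "0 \<le> s" "s \<le> t" "t < b" "t < T\<^sub>F"
  shows "action (z t) - \<rho>s t \<le> action (z s) - \<rho>s s"
proof (rule nonincreasing_of_derivative[of 0 "min b T\<^sub>F" "\<lambda>t. action (z t) - \<rho>s t"
      "\<lambda>t. - dH_theta t (z t) - deriv \<rho>s t"])
  fix r assume r: "r \<in> {0..<min b T\<^sub>F}"
  then have rF: "r \<in> {0..<T\<^sub>F}"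
    by simp
  show "((\<lambda>t. action (z t) - \<rho>s t) has_real_derivative - dH_theta r (z r) - deriv \<rho>s r)
      (at r within {0..<min b T\<^sub>F})"
    using r by (intro DERIV_diff action_has_real_derivative[OF sol]
        has_field_derivative_at_within[OF \<rho>s_has_real_derivative[OF rF]]) auto
  show "- dH_theta r (z r) - deriv \<rho>s r \<le> 0"
    using dH_theta_ge[OF rF, of "z r"] by linarith
qed (use st in auto)

lemma action_le_if_dH_theta_eq_0:
  assumes sol: "ham_solution H z0 {0..<b} z" and "0 \<le> a"
    and S: "{a..<b} \<subseteq> {0..<T\<^sub>F} \<or> {a..<b} \<subseteq> {T\<^sub>F..<T}"
    and zero: "\<And>t. t \<in> {a..<b} \<Longrightarrow> dH_theta t (z t) = 0" and t: "t \<in> {a..<b}"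
  shows "action (z t) \<le> action (z a)"
proof (rule nonincreasing_of_derivative[of a b "\<lambda>t. action (z t)" "\<lambda>t. - dH_theta t (z t)"])
  fix r assume "r \<in> {a..<b}"
  then show "((\<lambda>t. action (z t)) has_real_derivative - dH_theta r (z r)) (at r within {a..<b})"
    using action_has_real_derivative[OF sol \<open>0 \<le> a\<close> order_refl S] by blast
qed (use t zero in auto)

lemma blow_up_time:
  assumes blow: "blows_up_at H z0 z b" and "b \<le> T"
  shows "b = T\<^sub>F"
proof (rule ccontr)
  assume "b \<noteq> T\<^sub>F"
  have "0 < b" and sol: "ham_solution H z0 {0..<b} z"
    using blow by (auto simp: blows_up_at_def)
  consider "b < T\<^sub>F" | "T\<^sub>F < b"
    using \<open>b \<noteq> T\<^sub>F\<close> by linarith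
  then have "\<not> blows_up_at H z0 z b"
  proof cases
    case 1
    show ?thesis
    proof (rule not_blows_up_at_if_action_bounded[OF sol order_refl \<open>0 < b\<close>])
      fix t assume t: "t \<in> {0..<b}"
      have "\<rho>s t \<le> \<rho>s b"
        unfolding rho_star_def using t 1 \<sigma>_pos T\<^sub>F_pos \<beta>
        by (auto intro!: divide_left_mono powr_mono2 mult_pos_pos)
      \<comment> \<open>The difference of action and \<open>\<rho>s\<close> is at most its initial
        value, and \<open>\<rho>s\<close> is increasing and finite at \<open>b\<close>.\<close>
      then show "action (z t) \<le> action (z 0) - \<rho>s 0 + \<rho>s b"
        using action_minus_\<rho>s_nonincreasing[OF sol, of 0 t] t 1 by auto
      show "\<bar>dH_theta t (z t)\<bar> \<le> deriv \<rho>s b + \<beta> / T\<^sub>F"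
        using abs_dH_theta_le[of t "z t"] deriv_\<rho>s_mono[of t b] t 1 by auto
    qed (use 1 in auto)
  next
    case 2
    show ?thesis
    \<comment> \<open>The solution already exists at \<open>T\<^sub>F\<close>, so its action there
      is a finite bound for all later times.\<close>
    proof (rule not_blows_up_at_if_action_bounded[OF sol _ 2])
      show S: "{T\<^sub>F..<b} \<subseteq> {0..<T\<^sub>F} \<or> {T\<^sub>F..<b} \<subseteq> {T\<^sub>F..<T}"
        using \<open>b \<le> T\<close> by auto
      fix t assume t: "t \<in> {T\<^sub>F..<b}"
      then show "\<bar>dH_theta t (z t)\<bar> \<le> 0"
        by (simp add: dH_theta_def)
      show "action (z t) \<le> action (z T\<^sub>F)"
        by (rule action_le_if_dH_theta_eq_0[OF sol _ S _ t])
          (use T\<^sub>F_pos in \<open>auto simp: dH_theta_def\<close>)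
    qed (use T\<^sub>F_pos in auto)
  qed
  with blow show False
    by contradiction
qed

lemma blow_up_action_ge:
  assumes blow: "blows_up_at H z0 z T\<^sub>F" and s: "s \<in> {0..<T\<^sub>F}"
  shows "action (z s) \<ge> \<rho>s s - 1/2"
proof (rule ccontr)
  assume "\<not> action (z s) \<ge> \<rho>s s - 1/2"
  then have less: "action (z s) < \<rho>s s - 1/2"
    by simp
  have sol: "ham_solution H z0 {0..<T\<^sub>F} z"
    using blow by (auto simp: blows_up_at_def)
  \<comment> \<open>By monotonicity the action stays more than 1/2 below \<open>\<rho>s\<close>,
    outside the support of \<open>g\<close>.\<close>
  have zero: "dH_theta t (z t) = 0" if t: "t \<in> {s..<T\<^sub>F}" for t
    using action_minus_\<rho>s_nonincreasing[OF sol, of s t] s t less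
      g_eq_0(1)[of "action (z t) - \<rho>s t"] by (auto simp: dH_theta_def)
  have S: "{s..<T\<^sub>F} \<subseteq> {0..<T\<^sub>F} \<or> {s..<T\<^sub>F} \<subseteq> {T\<^sub>F..<T}"
    using s by auto
  have "\<not> blows_up_at H z0 z T\<^sub>F"
    by (rule not_blows_up_at_if_action_bounded[OF sol _ _ S, of "action (z s)" 0])
      (use s zero action_le_if_dH_theta_eq_0[OF sol _ S] in auto)
  with blow show False
    by contradiction
qed

lemma rot_eq:
  assumes "t \<in> {0..<T\<^sub>F}" and "\<And>r. r \<in> {0..t} \<Longrightarrow> z r \<noteq> 0"
  shows "rot H z t = 1 / (2 * pi) * integral {0..t} (\<lambda>r. dH_rho r (z r))"
proof -
  have "integral {0..t} (\<lambda>r. ((J *v gradient (H r) (z r)) \<bullet> (J *v z r)) / (norm (z r))\<^sup>2) =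
      integral {0..t} (\<lambda>r. dH_rho r (z r))"
    by (intro integral_cong J_gradient_H_inner_J) (use assms T\<^sub>F_le in auto)
  then show ?thesis
    by (simp only: rot_def)
qed

text \<open>The factor \<open>(1/2) powr (\<alpha> - 1)\<close> comes from the action being at least
  \<open>\<rho>s / 2\<close>, the subtracted term from the perturbation of the angular speed. The
  two sides are compared through their derivatives.\<close>

lemma blow_up_rot_ge:
  assumes blow: "blows_up_at H z0 z T\<^sub>F" and t: "t \<in> {0..<T\<^sub>F}"
  shows "rot H z t \<ge> 1 / (2 * pi) * ((1/2) powr (\<alpha> - 1) * \<theta>s t - \<epsilon> * L * T\<^sub>F)"
proof -
  have half: "action (z r) \<ge> \<rho>s r / 2" if "r \<in> {0..<T\<^sub>F}" for r
    using blow_up_action_ge[OF blow that] \<rho>s_ge_1[OF that] by simp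
  have nz: "z r \<noteq> 0" if "r \<in> {0..<T\<^sub>F}" for r
    using half[OF that] \<rho>s_ge_1[OF that] by auto
  have sol: "ham_solution H z0 {0..<T\<^sub>F} z"
    using blow by (auto simp: blows_up_at_def)
  have "continuous_on {0..<T\<^sub>F} z"
    using sol by (rule ham_solution_continuous_on_half_open)
  then have cont: "continuous_on {0..<T\<^sub>F} (\<lambda>r. dH_rho r (z r))"
    by (intro continuous_on_dH_rho) auto
  let ?I = "\<lambda>t. integral {0..t} (\<lambda>r. dH_rho r (z r))"
  have "(1/2) powr (\<alpha> - 1) * \<theta>s t - \<epsilon> * L * t - ?I t \<le> (1/2) powr (\<alpha> - 1) * \<theta>s 0 - \<epsilon> * L * 0 - ?I 0"
  proof (rule nonincreasing_of_derivative[of 0 T\<^sub>F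
        "\<lambda>t. (1/2) powr (\<alpha> - 1) * \<theta>s t - \<epsilon> * L * t - ?I t"
        "\<lambda>t. (1/2) powr (\<alpha> - 1) * (\<alpha> * \<rho>s t powr (\<alpha> - 1)) - \<epsilon> * L * 1 - dH_rho t (z t)"])
    fix r assume r: "r \<in> {0..<T\<^sub>F}"
    have "(?I has_real_derivative dH_rho r (z r)) (at r within {0..<T\<^sub>F})"
      using integral_has_vector_derivative_atLeastLessThan[OF cont r]
      by (simp add: has_real_derivative_iff_has_vector_derivative)
    then show "((\<lambda>t. (1/2) powr (\<alpha> - 1) * \<theta>s t - \<epsilon> * L * t - ?I t) has_real_derivative
        (1/2) powr (\<alpha> - 1) * (\<alpha> * \<rho>s r powr (\<alpha> - 1)) - \<epsilon> * L * 1 - dH_rho r (z r))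
        (at r within {0..<T\<^sub>F})"
      by (intro DERIV_diff DERIV_cmult \<theta>s_has_real_derivative r DERIV_ident)
    have "(1/2) powr (\<alpha> - 1) * \<rho>s r powr (\<alpha> - 1) = (1/2 * \<rho>s r) powr (\<alpha> - 1)"
      using \<rho>s_ge_1[OF r] by (subst powr_mult) auto
    also have "\<dots> \<le> action (z r) powr (\<alpha> - 1)"
      using half[OF r] \<rho>s_ge_1[OF r] \<alpha> by (intro powr_mono2) auto
    finally have "\<alpha> * ((1/2) powr (\<alpha> - 1) * \<rho>s r powr (\<alpha> - 1)) \<le> \<alpha> * action (z r) powr (\<alpha> - 1)"
      using \<alpha> by simp
    then have "(1/2) powr (\<alpha> - 1) * (\<alpha> * \<rho>s r powr (\<alpha> - 1)) \<le> \<alpha> * action (z r) powr (\<alpha> - 1)"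
      by (simp only: mult.left_commute)
    moreover have "\<bar>dH_rho r (z r) - \<alpha> * action (z r) powr (\<alpha> - 1)\<bar> \<le> \<epsilon> * L"
      using r by (intro abs_dH_rho_le) auto
    ultimately show "(1/2) powr (\<alpha> - 1) * (\<alpha> * \<rho>s r powr (\<alpha> - 1)) - \<epsilon> * L * 1 - dH_rho r (z r) \<le> 0"
      by linarith
  qed (use t in auto)
  moreover have "\<epsilon> * L * t \<le> \<epsilon> * L * T\<^sub>F"
    using \<epsilon>_nonneg L_nonneg t by (intro mult_left_mono) auto
  ultimately have "(1/2) powr (\<alpha> - 1) * \<theta>s t - \<epsilon> * L * T\<^sub>F \<le> ?I t"
    by simp
  moreover have "rot H z t = 1 / (2 * pi) * ?I t"
    using t nz by (intro rot_eq) auto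
  ultimately show ?thesis
    by (simp add: divide_right_mono)
qed

lemma blow_up_rot_at_top:
  assumes "\<beta> * (\<alpha> - 1) \<ge> 1" and blow: "blows_up_at H z0 z T\<^sub>F"
  shows "filterlim (rot H z) at_top (at_left T\<^sub>F)"
proof (rule filterlim_at_top_mono)
  have "filterlim (\<lambda>t. - (\<epsilon> * L * T\<^sub>F) + (1/2) powr (\<alpha> - 1) * \<theta>s t) at_top (at_left T\<^sub>F)"
    by (intro filterlim_tendsto_add_at_top[OF tendsto_const]
        filterlim_tendsto_pos_mult_at_top[OF tendsto_const] \<theta>s_at_top assms) auto
  then show "filterlim (\<lambda>t. 1 / (2 * pi) * ((1/2) powr (\<alpha> - 1) * \<theta>s t - \<epsilon> * L * T\<^sub>F)) at_top (at_left T\<^sub>F)"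
    by (intro filterlim_tendsto_pos_mult_at_top[OF tendsto_const]) auto
  have "\<forall>\<^sub>F t in at_left T\<^sub>F. t \<in> {0<..<T\<^sub>F}"
    using T\<^sub>F_pos by (rule eventually_at_left_real)
  then show "\<forall>\<^sub>F t in at_left T\<^sub>F. 1 / (2 * pi) * ((1/2) powr (\<alpha> - 1) * \<theta>s t - \<epsilon> * L * T\<^sub>F) \<le> rot H z t"
    by eventually_elim (use blow_up_rot_ge[OF blow] in auto)
qed

section \<open>The spiral solution\<close>

definition spiral :: "real \<Rightarrow> real^2" where
  "spiral t = polar (\<theta>s t) (\<rho>s t)"

lemma action_spiral: "t \<in> {0..<T\<^sub>F} \<Longrightarrow> action (spiral t) = \<rho>s t"
  unfolding spiral_def using \<rho>s_ge_1[of t] by (intro action_polar) auto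

lemma spiral_nonzero: "t \<in> {0..<T\<^sub>F} \<Longrightarrow> spiral t \<noteq> 0"
  using action_spiral[of t] \<rho>s_ge_1[of t] by auto

text \<open>The spiral follows the centre of the bump: there \<open>g\<close> is 1 with derivative
  0, and the angle differs from \<open>\<theta>s t\<close> by a multiple of the period, so
  \<open>f t\<close> has the slope prescribed at 0.\<close>

lemma dH_spiral:
  assumes t: "t \<in> {0..<T\<^sub>F}"
  shows "dH_rho t (spiral t) = \<alpha> * \<rho>s t powr (\<alpha> - 1)" "dH_theta t (spiral t) = - deriv \<rho>s t"
proof -
  show "dH_rho t (spiral t) = \<alpha> * \<rho>s t powr (\<alpha> - 1)"
    by (simp add: dH_rho_def action_spiral[OF t] g_deriv_0)
  have "\<rho>s t > 0"
    using \<rho>s_ge_1[OF t] by simp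
  then obtain n :: int where "angle (spiral t) = \<theta>s t + 2 * pi * of_int n"
    using angle_polar unfolding spiral_def by blast
  then have "deriv (f t) (angle (spiral t) - \<theta>s t) = deriv (f t) 0"
    using periodic_int_shift[of "deriv (f t)" "2 * pi" 0 n] deriv_f_periodic[OF t] by simp
  then show "dH_theta t (spiral t) = - deriv \<rho>s t"
    using t by (simp add: dH_theta_def action_spiral[OF t] g_0 f_deriv_0)
qed

lemma spiral_has_vector_derivative:
  assumes t: "t \<in> {0..<T\<^sub>F}"
  shows "(spiral has_vector_derivative J *v gradient (H t) (spiral t)) (at t within {0..<T\<^sub>F})"
proof -
  have pos: "\<rho>s t > 0"
    using \<rho>s_ge_1[OF t] by simp
  let ?\<omega> = "\<alpha> * \<rho>s t powr (\<alpha> - 1)" and ?r = "sqrt (2 * \<rho>s t)"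
  have trig: "((\<lambda>t. F t * cos (\<theta>s t)) has_real_derivative F' * cos (\<theta>s t) - F t * sin (\<theta>s t) * ?\<omega>)
        (at t within {0..<T\<^sub>F})"
      "((\<lambda>t. F t * sin (\<theta>s t)) has_real_derivative F' * sin (\<theta>s t) + F t * cos (\<theta>s t) * ?\<omega>)
        (at t within {0..<T\<^sub>F})"
    if "(F has_real_derivative F') (at t within {0..<T\<^sub>F})" for F F'
    using that by (auto intro!: derivative_eq_intros \<theta>s_has_real_derivative t)
  \<comment> \<open>The radius is the root of twice the action, so its speed is that of the action
    divided by the radius.\<close>
  have "((\<lambda>t. sqrt (2 * \<rho>s t)) has_real_derivative deriv \<rho>s t / ?r) (at t within {0..<T\<^sub>F})"
    using pos by (auto intro!: derivative_eq_intros
        has_field_derivative_at_within[OF \<rho>s_has_real_derivative[OF t]] simp: field_simps)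
  note der = trig[OF this, unfolded has_real_derivative_iff_has_vector_derivative]
  have "((\<lambda>t. (sqrt (2 * \<rho>s t) * cos (\<theta>s t)) *\<^sub>R axis 1 1 -
        (sqrt (2 * \<rho>s t) * sin (\<theta>s t)) *\<^sub>R axis 2 1 :: real^2) has_vector_derivative
      (deriv \<rho>s t / ?r * cos (\<theta>s t) - ?r * sin (\<theta>s t) * ?\<omega>) *\<^sub>R axis 1 1 -
      (deriv \<rho>s t / ?r * sin (\<theta>s t) + ?r * cos (\<theta>s t) * ?\<omega>) *\<^sub>R axis 2 1) (at t within {0..<T\<^sub>F})"
    by (intro has_vector_derivative_diff der
        bounded_linear.has_vector_derivative[OF bounded_linear_scaleR_left])
  then have "(spiral has_vector_derivative
      (deriv \<rho>s t / ?r * cos (\<theta>s t) - ?r * sin (\<theta>s t) * ?\<omega>) *\<^sub>R axis 1 1 -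
      (deriv \<rho>s t / ?r * sin (\<theta>s t) + ?r * cos (\<theta>s t) * ?\<omega>) *\<^sub>R axis 2 1) (at t within {0..<T\<^sub>F})"
    by (simp add: spiral_def[abs_def] polar_eq)
  moreover have "J *v gradient (H t) (spiral t) = ?\<omega> *\<^sub>R (J *v spiral t) + (deriv \<rho>s t / ?r\<^sup>2) *\<^sub>R spiral t"
  proof -
    have "(norm (spiral t))\<^sup>2 = ?r\<^sup>2"
      using action_spiral[OF t] pos by (simp add: action_def)
    then show ?thesis
      using t T\<^sub>F_le by (simp add: J_gradient_H dH_spiral)
  qed
  moreover have "?\<omega> *\<^sub>R (J *v spiral t) + (deriv \<rho>s t / ?r\<^sup>2) *\<^sub>R spiral t =
      (deriv \<rho>s t / ?r * cos (\<theta>s t) - ?r * sin (\<theta>s t) * ?\<omega>) *\<^sub>R axis 1 1 -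
      (deriv \<rho>s t / ?r * sin (\<theta>s t) + ?r * cos (\<theta>s t) * ?\<omega>) *\<^sub>R axis 2 1"
  proof -
    \<comment> \<open>The comparison of both velocities is an identity in free real parameters; it
      uses only that the radius is nonzero, to cancel one power of it.\<close>
    have "\<omega> *\<^sub>R (J *v ((r * c) *\<^sub>R axis 1 1 - (r * s) *\<^sub>R axis 2 1)) +
        (d / r\<^sup>2) *\<^sub>R ((r * c) *\<^sub>R axis 1 1 - (r * s) *\<^sub>R axis 2 1) =
        (d / r * c - r * s * \<omega>) *\<^sub>R axis 1 1 - (d / r * s + r * c * \<omega>) *\<^sub>R axis 2 1"
      if "r \<noteq> 0" for \<omega> r c s d :: real
      using that by (simp add: vec_eq_iff forall_2 axis_def power2_eq_square algebra_simps)
    note this[of ?r]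
    moreover have "?r \<noteq> 0"
      using pos by simp
    ultimately show ?thesis
      unfolding spiral_def polar_eq by blast
  qed
  ultimately show ?thesis
    by simp
qed

text \<open>The derivative computed above integrates to the solution property, and the norm is the
  root of \<open>2 * \<rho>s t\<close>, which tends to infinity.\<close>

lemma blows_up_at_spiral: "blows_up_at H (spiral 0) spiral T\<^sub>F"
proof (rule blows_up_at_if_norm_at_top[OF _ T\<^sub>F_pos])
  have "continuous_on {0..<T\<^sub>F} spiral"
    using spiral_has_vector_derivative has_vector_derivative_continuous
    by (force simp: continuous_on_eq_continuous_within)
  then have cont: "continuous_on {0..<T\<^sub>F} (\<lambda>t. J *v gradient (H t) (spiral t))"
    by (intro continuous_on_rhs) auto
  show "ham_solution H (spiral 0) {0..<T\<^sub>F} spiral"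
    unfolding ham_solution_def
  proof
    fix t assume t: "t \<in> {0..<T\<^sub>F}"
    let ?v = "\<lambda>r. J *v gradient (H r) (spiral r)"
    have sub: "{0..t} \<subseteq> {0..<T\<^sub>F}"
      using t by auto
    have "(?v has_integral spiral t - spiral 0) {0..t}"
      using t sub by (intro fundamental_theorem_of_calculus
          has_vector_derivative_within_subset[OF spiral_has_vector_derivative]) auto
    moreover have "?v absolutely_integrable_on {0..t}"
      by (rule absolutely_integrable_continuous_real) (rule continuous_on_subset[OF cont sub])
    ultimately show "?v absolutely_integrable_on {0..t} \<and> spiral t = spiral 0 + integral {0..t} ?v"
      by (simp add: integral_unique)
  qed
  have "filterlim (\<lambda>t. sqrt (2 * \<rho>s t)) at_top (at_left T\<^sub>F)"
    by (intro filterlim_compose[OF sqrt_at_top]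
        filterlim_tendsto_pos_mult_at_top[OF tendsto_const _ \<rho>s_at_top]) auto
  moreover have "\<forall>\<^sub>F t in at_left T\<^sub>F. t \<in> {0<..<T\<^sub>F}"
    using T\<^sub>F_pos by (rule eventually_at_left_real)
  then have "\<forall>\<^sub>F t in at_left T\<^sub>F. sqrt (2 * \<rho>s t) \<le> norm (spiral t)"
  proof eventually_elim
    case (elim t)
    then have "2 * \<rho>s t = (norm (spiral t))\<^sup>2"
      using action_spiral[of t] by (simp add: action_def)
    then show ?case
      by simp
  qed
  ultimately show "filterlim (\<lambda>t. norm (spiral t)) at_top (at_left T\<^sub>F)"
    by (rule filterlim_at_top_mono)
qed

lemma rot_spiral:
  assumes t: "t \<in> {0..<T\<^sub>F}"
  shows "rot H spiral t = \<theta>s t / (2 * pi)"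
proof -
  have sub: "{0..t} \<subseteq> {0..<T\<^sub>F}"
    using t by auto
  have "((\<lambda>r. \<alpha> * \<rho>s r powr (\<alpha> - 1)) has_integral \<theta>s t - \<theta>s 0) {0..t}"
    using t sub by (intro fundamental_theorem_of_calculus)
      (auto simp flip: has_real_derivative_iff_has_vector_derivative
        intro!: DERIV_subset[OF \<theta>s_has_real_derivative])
  then have "integral {0..t} (\<lambda>r. \<alpha> * \<rho>s r powr (\<alpha> - 1)) = \<theta>s t - \<theta>s 0"
    by (rule integral_unique)
  moreover have "integral {0..t} (\<lambda>r. dH_rho r (spiral r)) = integral {0..t} (\<lambda>r. \<alpha> * \<rho>s r powr (\<alpha> - 1))"
    by (rule integral_cong) (use sub in \<open>auto intro!: dH_spiral\<close>)
  moreover have "rot H spiral t = 1 / (2 * pi) * integral {0..t} (\<lambda>r. dH_rho r (spiral r))"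
    using sub spiral_nonzero by (intro rot_eq t) auto
  ultimately show ?thesis
    by simp
qed

lemma not_rot_spiral_at_top:
  assumes "\<beta> * (\<alpha> - 1) < 1"
  shows "\<not> filterlim (rot H spiral) at_top (at_left T\<^sub>F)"
proof
  obtain B where B: "\<And>t. t \<in> {0..<T\<^sub>F} \<Longrightarrow> \<theta>s t \<le> B"
    using \<theta>s_bounded[OF assms] by blast
  assume "filterlim (rot H spiral) at_top (at_left T\<^sub>F)"
  then have "\<forall>\<^sub>F t in at_left T\<^sub>F. rot H spiral t \<ge> B / (2 * pi) + 1"
    by (auto simp: filterlim_at_top)
  moreover have "\<forall>\<^sub>F t in at_left T\<^sub>F. t \<in> {0<..<T\<^sub>F}"
    using T\<^sub>F_pos by (rule eventually_at_left_real)
  ultimately have "\<forall>\<^sub>F t in at_left T\<^sub>F. False"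
  proof eventually_elim
    case (elim t)
    then have "\<theta>s t / (2 * pi) \<le> B / (2 * pi)"
      using B[of t] by (intro divide_right_mono) auto
    then show False
      using elim rot_spiral[of t] by auto
  qed
  then show False
    by simp
qed

section \<open>The equivalence, with the spiral as the counterexample below the threshold\<close>

theorem rot_at_top_iff:
  "(\<forall>z0 z b. b \<in> {0<..T} \<and> blows_up_at H z0 z b \<longrightarrow> filterlim (rot H z) at_top (at_left b))
    \<longleftrightarrow> \<beta> * (\<alpha> - 1) \<ge> 1"
proof
  assume "\<forall>z0 z b. b \<in> {0<..T} \<and> blows_up_at H z0 z b \<longrightarrow> filterlim (rot H z) at_top (at_left b)"
  then have "filterlim (rot H spiral) at_top (at_left T\<^sub>F)"
    using blows_up_at_spiral T\<^sub>F_pos T\<^sub>F_le by auto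
  then show "\<beta> * (\<alpha> - 1) \<ge> 1"
    using not_rot_spiral_at_top by (meson not_le)
next
  assume "\<beta> * (\<alpha> - 1) \<ge> 1"
  then show "\<forall>z0 z b. b \<in> {0<..T} \<and> blows_up_at H z0 z b \<longrightarrow> filterlim (rot H z) at_top (at_left b)"
    using blow_up_time blow_up_rot_at_top by (metis greaterThanAtMost_iff)
qed

end

theorem lemma6p5:
  fixes T T\<^sub>F \<alpha> \<beta> \<sigma>\<^sub>0 \<epsilon> L\<^sub>g :: real
    and f :: "real \<Rightarrow> real \<Rightarrow> real" and g :: "real \<Rightarrow> real"
    and H :: "real \<Rightarrow> real^2 \<Rightarrow> real"
  assumes "0 < T" and "0 < T\<^sub>F" and "T\<^sub>F \<le> T"
    and "\<alpha> > 1" and "\<beta> > 0" and "\<sigma>\<^sub>0 \<ge> T\<^sub>F powr (\<beta> - 1)" and "\<epsilon> > 0"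
    and f_smooth: "smooth_on ({0..<T\<^sub>F} \<times> UNIV) (\<lambda>(t, u). f t u)"
    and f_range: "\<And>t u. t \<in> {0..<T\<^sub>F} \<Longrightarrow> f t u \<in> {-\<epsilon><..<\<epsilon>}"
    and f_norm: "(SUP (t, u)\<in>{0..<T\<^sub>F} \<times> UNIV. \<bar>f t u\<bar>) < \<epsilon>"
    and f_periodic: "\<And>t u. t \<in> {0..<T\<^sub>F} \<Longrightarrow> f t (u + 2 * pi) = f t u"
    and f_deriv_0: "\<And>t. t \<in> {0..<T\<^sub>F} \<Longrightarrow> deriv (f t) 0 = - deriv (rho_star T\<^sub>F \<beta> \<sigma>\<^sub>0) t"
    and f_deriv_lower: "\<And>t u. t \<in> {0..<T\<^sub>F} \<Longrightarrow> - deriv (rho_star T\<^sub>F \<beta> \<sigma>\<^sub>0) t \<le> deriv (f t) u"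
    and f_deriv_upper: "\<And>t u. t \<in> {0..<T\<^sub>F} \<Longrightarrow> deriv (f t) u < \<beta> / T\<^sub>F"
    and f_supp: "\<And>t. t \<in> {0..<T\<^sub>F} \<Longrightarrow>
          supp (f t) = {x + 2 * pi * of_int k |x k. x \<in> {-1/2..1/2} \<and> k \<in> (UNIV :: int set)}"
    and g_smooth: "smooth_on UNIV g"
    and g_range: "\<And>x. g x \<in> {0..1}"
    and g_supp: "supp g = {-1/2..1/2}"
    and g_0: "g 0 = 1" and g_deriv_0: "deriv g 0 = 0"
    and g_deriv_bound: "\<And>x. \<bar>deriv g x\<bar> \<le> L\<^sub>g"
    and H_def: "H = hamiltonian T T\<^sub>F \<alpha> \<beta> \<sigma>\<^sub>0 f g"
  shows "(\<forall>z0 z b. b \<in> {0<..T} \<and> blows_up_at H z0 z b \<longrightarrow>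
            filterlim (rot H z) at_top (at_left b))
         \<longleftrightarrow> \<beta> * (\<alpha> - 1) \<ge> 1"
proof -
  interpret driven_hamiltonian T T\<^sub>F \<alpha> \<beta> \<sigma>\<^sub>0 \<epsilon> L\<^sub>g f g
  proof
    show "\<bar>f t u\<bar> \<le> \<epsilon>" if "t \<in> {0..<T\<^sub>F}" for t u
      using f_range[OF that, of u] by auto
    show "deriv (f t) u \<le> \<beta> / T\<^sub>F" if "t \<in> {0..<T\<^sub>F}" for t u
      using f_deriv_upper[OF that, of u] by simp
  qed (fact assms)+
  show ?thesis
    unfolding H_def by (rule rot_at_top_iff)
qed

end
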